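(* For every integer $k \geq 6$, \[H^+(\infty,k)=\{2^{k-1}+2^i : i\in \{0,1,\dots,k-1\}\}\cup\{2^{k-1}+2^{k-5}+2^{k-6}\}.\]
   Context: Let $\mathbb{H}^n=\{0,1\}^n\subseteq\mathbb{R}^n$. For $n\geq k$, $H(n,k)$ is the set of all possible sizes $|S\cap \mathbb{H}^n|$ where $S$ ranges over $k$-dimensional linear subspaces of $\mathbb{R}^n$; equivalently, $H(n,k)=\{\,|\mathbb{H}^k\cap L^{-1}(\mathbb{H}^{n-k})| : L:\mathbb{R}^k\to\mathbb{R}^{n-k}\text{ linear}\,\}$. Let $H(\infty,k)=\bigcup_{n\geq k}H(n,k)$ and $H^+(\infty,k)=H(\infty,k)\setminus\{1,\dots,2^{k-1}\}$ (the intersection sizes larger than $2^{k-1}$). *)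

theory Defs
  imports Complex_Main
begin

text \<open>Vectors of R^m are represented as functions nat => real vanishing outside {..<m}.
  The 0/1 cube H^k inside R^k:\<close>
definition cube :: "nat \<Rightarrow> (nat \<Rightarrow> real) set" where
  "cube k = {x. (\<forall>i<k. x i \<in> {0, 1}) \<and> (\<forall>i\<ge>k. x i = 0)}"

text \<open>H(n,k): sizes of H^k \<inter> L^{-1}(H^{n-k}) for linear L : R^k -> R^{n-k},
  where L is given by its matrix A (rows j < n-k, columns i < k).\<close>
definition Hset :: "nat \<Rightarrow> nat \<Rightarrow> nat set" where
  "Hset n k = {card {x \<in> cube k. \<forall>j<n-k. (\<Sum>i<k. A j i * x i) \<in> {0, 1}} | A :: nat \<Rightarrow> nat \<Rightarrow> real. True}"

definition Hinf :: "nat \<Rightarrow> nat set" where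
  "Hinf k = (\<Union>n\<in>{k..}. Hset n k)"

definition Hplus :: "nat \<Rightarrow> nat set" where
  "Hplus k = Hinf k - {1..2^(k-1)}"

end

theory Submission
  imports Defs
begin

text \<open>
  Adding a homogenizing coordinate turns each row of \<open>L\<close> into a vector \<open>b\<close>, and the rows are
  satisfied exactly when \<open>\<bar>b \<cdot> y\<bar> = 1\<close> for the sign vector \<open>y \<in> {1, -1}^(k + 1)\<close>. If \<open>b\<close> has an entry
  outside \<open>{0, 1, -1}\<close>, flipping that sign of \<open>y\<close> shows that at most half of all \<open>y\<close> work; so in
  the large case all entries lie in \<open>{0, 1, -1}\<close> and the supports are odd. The basic move is to
  condition on \<open>y j = c * y i\<close>, which merges two coordinates of every vector; after a merge an entry
  \<open>\<plusminus>2\<close> costs a factor of one half. A single vector of support \<open>2 t + 1\<close> has density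
  \<open>1, 3/4, 5/8, 35/64, 63/128, ...\<close>. Two vectors that differ by more than a sign have density at
  most \<open>1/2\<close>, except for two triples (vectors of support 3) and for a triple inside a quintuple. Three such vectors have
  density at most \<open>1/2\<close> unless all are triples through a common pair with the same relative sign;
  these stars have density \<open>1/2 + 1/2^(m + 1)\<close> with \<open>m\<close> the number of triples.
\<close>

section \<open>Sign vectors and densities\<close>

definition signs :: "nat \<Rightarrow> (nat \<Rightarrow> real) set" where
  "signs N = {y. (\<forall>i<N. y i = 1 \<or> y i = -1) \<and> (\<forall>i\<ge>N. y i = 0)}"

definition flip :: "nat \<Rightarrow> (nat \<Rightarrow> real) \<Rightarrow> nat \<Rightarrow> real" where
  "flip j y = y(j := - y j)"

definition dot :: "nat \<Rightarrow> (nat \<Rightarrow> real) \<Rightarrow> (nat \<Rightarrow> real) \<Rightarrow> real" where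
  "dot N b y = (\<Sum>i<N. b i * y i)"

definition ok :: "nat \<Rightarrow> (nat \<Rightarrow> real) set \<Rightarrow> (nat \<Rightarrow> real) \<Rightarrow> bool" where
  "ok N B y \<longleftrightarrow> (\<forall>b\<in>B. \<bar>dot N b y\<bar> = 1)"

definition avg :: "nat \<Rightarrow> ((nat \<Rightarrow> real) \<Rightarrow> real) \<Rightarrow> real" where
  "avg N f = (\<Sum>y\<in>signs N. f y) / 2 ^ N"

definition dens :: "nat \<Rightarrow> (nat \<Rightarrow> real) set \<Rightarrow> real" where
  "dens N B = avg N (\<lambda>y. of_bool (ok N B y))"

definition supp :: "(nat \<Rightarrow> real) \<Rightarrow> nat set" where
  "supp b = {i. b i \<noteq> 0}"

text \<open>Substitution of \<open>y j = c * y i\<close> into \<open>b \<cdot> y\<close>.\<close>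
definition merge :: "nat \<Rightarrow> nat \<Rightarrow> real \<Rightarrow> (nat \<Rightarrow> real) \<Rightarrow> nat \<Rightarrow> real" where
  "merge i j c b = b(i := b i + c * b j, j := 0)"

text \<open>The scalar product with a sign vector has the parity of the support size, so odd support
  is exactly the parity compatible with the value 1 or -1. The bound by \<open>N\<close> ensures
  that \<open>dot\<close> sees every nonzero entry.\<close>

definition oddvec :: "nat \<Rightarrow> (nat \<Rightarrow> real) \<Rightarrow> bool" where
  "oddvec N b \<longleftrightarrow> (\<forall>i. b i = 0 \<or> b i = 1 \<or> b i = -1) \<and> supp b \<subseteq> {..<N} \<and> odd (card (supp b))"

lemma signs_Suc:
  "signs (Suc N) = (\<lambda>y. y(N := 1)) ` signs N \<union> (\<lambda>y. y(N := -1)) ` signs N"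
proof (intro equalityI subsetI)
  fix y assume y: "y \<in> signs (Suc N)"
  have z: "y(N := 0) \<in> signs N" using y by (auto simp: signs_def)
  have "y N = 1 \<or> y N = -1" using y by (auto simp: signs_def)
  then have "y = (y(N := 0))(N := 1) \<or> y = (y(N := 0))(N := -1)" by auto
  then show "y \<in> (\<lambda>y. y(N := 1)) ` signs N \<union> (\<lambda>y. y(N := -1)) ` signs N"
    using z by blast
next
  fix y assume "y \<in> (\<lambda>y. y(N := 1)) ` signs N \<union> (\<lambda>y. y(N := -1)) ` signs N"
  then show "y \<in> signs (Suc N)"
    unfolding signs_def by (auto simp: less_Suc_eq)
qed

lemma inj_on_upd_signs: "inj_on (\<lambda>y. y(N := v)) (signs N)"
proof (rule inj_onI)
  fix x y :: "nat \<Rightarrow> real"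
  assume xy: "x \<in> signs N" "y \<in> signs N" "x(N := v) = y(N := v)"
  show "x = y"
  proof
    fix i show "x i = y i"
      using xy(1,2) fun_cong[OF xy(3), of i] by (cases "i = N") (simp_all add: signs_def)
  qed
qed

lemma signs_finite_card: "finite (signs N) \<and> card (signs N) = 2 ^ N"
proof (induction N)
  case 0
  have "signs 0 = {\<lambda>_. 0}" by (auto simp: signs_def)
  then show ?case by simp
next
  case (Suc N)
  have "(\<lambda>y. y(N := 1::real)) ` signs N \<inter> (\<lambda>y. y(N := -1)) ` signs N = {}"
  proof (clarsimp simp: disjoint_iff)
    fix x y :: "nat \<Rightarrow> real"
    assume "x(N := 1) = y(N := -1)"
    from fun_cong[OF this, of N] show False by simp
  qed
  then show ?case
    using Suc by (simp add: signs_Suc card_Un_disjoint card_image[OF inj_on_upd_signs])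
qed

lemmas finite_signs [simp] = signs_finite_card[THEN conjunct1]
lemmas card_signs = signs_finite_card[THEN conjunct2]

lemma signs_pm: "y \<in> signs N \<Longrightarrow> i < N \<Longrightarrow> y i = 1 \<or> y i = -1"
  by (simp add: signs_def)

lemma flip_bij: "bij_betw (flip j) (signs N) (signs N)"
proof (rule bij_betw_byWitness[where f' = "flip j"])
  show "flip j ` signs N \<subseteq> signs N"
  proof
    fix x assume "x \<in> flip j ` signs N"
    then obtain y where y: "y \<in> signs N" "x = flip j y" by blast
    have "x i = 1 \<or> x i = -1" if "i < N" for i
      using signs_pm[OF y(1) that] y(2) by (auto simp: flip_def)
    moreover have "x i = 0" if "i \<ge> N" for i
      using y that by (auto simp: flip_def signs_def)
    ultimately show "x \<in> signs N" by (simp add: signs_def)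
  qed
  then show "flip j ` signs N \<subseteq> signs N" .
qed (auto simp: flip_def)

section \<open>Averages over sign vectors and conditioning on one relation between two signs\<close>

lemma avg_flip: "avg N (\<lambda>y. f (flip j y)) = avg N f"
  unfolding avg_def using sum.reindex_bij_betw[OF flip_bij, of f j N] by simp

lemma avg_add: "avg N (\<lambda>y. f y + g y) = avg N f + avg N g"
  by (simp add: avg_def sum.distrib add_divide_distrib)

lemma avg_cmult: "avg N (\<lambda>y. c * f y) = c * avg N f"
  by (simp add: avg_def sum_distrib_left)

lemma avg_sum: "avg N (\<lambda>y. \<Sum>a\<in>A. f a y) = (\<Sum>a\<in>A. avg N (f a))"
  unfolding avg_def sum_divide_distrib by (subst sum.swap) simp

lemma avg_cong: "(\<And>y. y \<in> signs N \<Longrightarrow> f y = g y) \<Longrightarrow> avg N f = avg N g"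
  by (simp add: avg_def)

lemma avg_mono: "(\<And>y. y \<in> signs N \<Longrightarrow> f y \<le> g y) \<Longrightarrow> avg N f \<le> avg N g"
  by (simp add: avg_def divide_right_mono sum_mono)

lemma avg_one: "avg N (\<lambda>y. 1) = 1"
  by (simp add: avg_def card_signs)

text \<open>Exactly one of \<open>y\<close> and \<open>flip j y\<close> satisfies the relation
  between the signs at \<open>i\<close> and \<open>j\<close>, while \<open>f\<close> takes the same
  value on both. Averaging over these pairs gives half of the average of \<open>f\<close>.\<close>

lemma avg_half:
  assumes "i \<noteq> j" "i < N" "j < N" "c = 1 \<or> c = -1"
    and inv: "\<And>y. y \<in> signs N \<Longrightarrow> f (flip j y) = f y"
  shows "avg N (\<lambda>y. of_bool (y j = c * y i) * f y) = avg N f / 2"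
proof -
  let ?g = "\<lambda>y. of_bool (y j = c * y i) * f y"
  have "avg N f = avg N (\<lambda>y. ?g y + ?g (flip j y))"
  proof (rule avg_cong)
    fix y assume y: "y \<in> signs N"
    show "f y = ?g y + ?g (flip j y)"
      using signs_pm[OF y assms(2)] signs_pm[OF y assms(3)] assms(1,4) inv[OF y]
      by (auto simp: flip_def)
  qed
  also have "\<dots> = avg N ?g + avg N ?g"
    by (simp only: avg_add avg_flip[of N ?g j])
  finally show ?thesis by simp
qed

section \<open>Scalar products and densities under flips and merges\<close>

lemma dot_upd: "i < N \<Longrightarrow> dot N (b(i := v)) y = dot N b y + (v - b i) * y i"
  unfolding dot_def
  by (subst (1 2) sum.remove[of _ i]) (auto simp: algebra_simps intro!: sum.cong)

lemma dot_flip: "i < N \<Longrightarrow> dot N b (flip i y) = dot N b y - 2 * b i * y i"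
  unfolding dot_def flip_def
  by (subst (1 2) sum.remove[of _ i]) (auto simp: algebra_simps intro!: sum.cong)

lemma dot_merge:
  "i \<noteq> j \<Longrightarrow> i < N \<Longrightarrow> j < N \<Longrightarrow> y j = c * y i \<Longrightarrow> dot N (merge i j c b) y = dot N b y"
  by (simp add: merge_def dot_upd algebra_simps)

lemma dot_supp:
  assumes "supp b \<subseteq> {..<N}"
  shows "dot N b y = (\<Sum>i\<in>supp b. b i * y i)"
  unfolding dot_def using assms by (intro sum.mono_neutral_right) (auto simp: supp_def)

text \<open>Under the condition, merging leaves every scalar product unchanged. The merged vectors
  vanish at \<open>j\<close>, so their condition is independent of the sign there and
  \<open>avg_half\<close> contributes the factor one half.\<close>

lemma avg_merge:
  assumes "i \<noteq> j" "i < N" "j < N" "c = 1 \<or> c = -1"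
  shows "avg N (\<lambda>y. of_bool (y j = c * y i) * of_bool (ok N B y)) = dens N (merge i j c ` B) / 2"
proof -
  have "avg N (\<lambda>y. of_bool (y j = c * y i) * of_bool (ok N B y)) =
        avg N (\<lambda>y. of_bool (y j = c * y i) * of_bool (ok N (merge i j c ` B) y))"
    using assms by (intro avg_cong) (auto simp: ok_def dot_merge)
  also have "\<dots> = avg N (\<lambda>y. of_bool (ok N (merge i j c ` B) y)) / 2"
  proof (rule avg_half[OF assms])
    fix y :: "nat \<Rightarrow> real"
    have "dot N (merge i j c b) (flip j y) = dot N (merge i j c b) y" for b
      using assms by (simp add: dot_flip) (simp add: merge_def)
    then show "of_bool (ok N (merge i j c ` B) (flip j y)) = (of_bool (ok N (merge i j c ` B) y) :: real)"
      by (simp add: ok_def)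
  qed
  finally show ?thesis by (simp add: dens_def)
qed

text \<open>Total probability over the two equally likely relations \<open>y j = c * y i\<close> and
  \<open>y j = - c * y i\<close>. Most later bounds come from choosing \<open>i\<close>,
  \<open>j\<close> and \<open>c\<close> and estimating the two branches separately.\<close>

lemma dens_split:
  assumes "i \<noteq> j" "i < N" "j < N" "c = 1 \<or> c = -1"
  shows "dens N B = (dens N (merge i j c ` B) + dens N (merge i j (-c) ` B)) / 2"
proof -
  have "dens N B = avg N (\<lambda>y. of_bool (y j = c * y i) * of_bool (ok N B y)
       + of_bool (y j = (-c) * y i) * of_bool (ok N B y))"
    unfolding dens_def
  proof (rule avg_cong)
    fix y assume y: "y \<in> signs N"
    show "of_bool (ok N B y) = of_bool (y j = c * y i) * of_bool (ok N B y)
       + of_bool (y j = (-c) * y i) * (of_bool (ok N B y) :: real)"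
      using signs_pm[OF y assms(2)] signs_pm[OF y assms(3)] assms(4) by auto
  qed
  also have "\<dots> = dens N (merge i j c ` B) / 2 + dens N (merge i j (-c) ` B) / 2"
    using assms avg_merge[OF assms, of B] avg_merge[OF assms(1-3), of "-c" B]
    by (subst avg_add) auto
  finally show ?thesis by simp
qed

lemma dens_empty: "dens N {} = 1"
  by (simp add: dens_def ok_def avg_one)

lemma dens_antimono: "B \<subseteq> C \<Longrightarrow> dens N C \<le> dens N B"
  unfolding dens_def by (rule avg_mono) (auto simp: ok_def)

lemma dens_le_1: "dens N B \<le> 1"
  using dens_antimono[of "{}" B N] by (simp add: dens_empty)

lemma dens_cong:
  "(\<And>y. y \<in> signs N \<Longrightarrow> ok N B y = ok N C y) \<Longrightarrow> dens N B = dens N C"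
  unfolding dens_def by (rule avg_cong) simp

lemma dot_neg: "dot N (\<lambda>i. - b i) y = - dot N b y"
  by (simp add: dot_def sum_negf)

text \<open>Flipping sign \<open>i\<close> changes the scalar product with \<open>b\<close> by twice
  the absolute value of \<open>b i\<close>. Two values in {1, -1} differ by 0 or 2 in absolute
  value, so at most one of \<open>y\<close> and its flip satisfies \<open>b\<close>; the conditions
  in \<open>B\<close> do not notice the flip.\<close>

lemma dens_big_entry:
  assumes "i < N" "b i \<noteq> 0" "b i \<noteq> 1" "b i \<noteq> -1" "\<And>b'. b' \<in> B \<Longrightarrow> b' i = 0"
  shows "dens N (insert b B) \<le> dens N B / 2"
proof -
  let ?g = "\<lambda>y. of_bool (ok N (insert b B) y) :: real"
  have "2 * dens N (insert b B) = avg N (\<lambda>y. ?g y + ?g (flip i y))"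
    by (simp add: avg_add avg_flip[of N ?g i] dens_def)
  also have "\<dots> \<le> dens N B"
    unfolding dens_def
  proof (rule avg_mono)
    fix y assume y: "y \<in> signs N"
    have "\<not> (\<bar>dot N b y\<bar> = 1 \<and> \<bar>dot N b (flip i y)\<bar> = 1)"
      using signs_pm[OF y assms(1)] assms(2-4) dot_flip[OF assms(1), of b y] by (auto simp: abs_if split: if_splits)
    moreover have "ok N B (flip i y) = ok N B y"
      unfolding ok_def using assms(1,5) by (intro ball_cong) (simp_all add: dot_flip[OF assms(1)] assms(5))
    ultimately show "?g y + ?g (flip i y) \<le> of_bool (ok N B y)"
      by (auto simp: ok_def)
  qed
  finally show ?thesis by simp
qed

lemma dens_big_entry_half:
  assumes "b \<in> B" "i < N" "b i \<noteq> 0" "b i \<noteq> 1" "b i \<noteq> -1"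
  shows "dens N B \<le> 1 / 2"
  using dens_big_entry[of i N b "{}"] dens_antimono[of "{b}" B N] assms by (simp add: dens_empty)

lemma oddvec_pm: "oddvec N b \<Longrightarrow> b i \<noteq> 0 \<Longrightarrow> b i = 1 \<or> b i = -1"
  by (auto simp: oddvec_def)

lemma oddvec_less: "oddvec N b \<Longrightarrow> b i \<noteq> 0 \<Longrightarrow> i < N"
  by (auto simp: oddvec_def supp_def)

lemma oddvec_finite: "oddvec N b \<Longrightarrow> finite (supp b)"
  by (auto simp: oddvec_def intro: finite_subset)

lemma ok_trivial:
  assumes "oddvec N b" "card (supp b) = 1" "y \<in> signs N"
  shows "\<bar>dot N b y\<bar> = 1"
proof -
  obtain m where m: "supp b = {m}" using assms(2) by (auto simp: card_1_singleton_iff)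
  then have "b m \<noteq> 0" by (auto simp: supp_def)
  then have "m < N" "b m = 1 \<or> b m = -1" using assms(1) oddvec_less oddvec_pm by auto
  moreover have "dot N b y = b m * y m"
    using assms(1) m by (simp add: dot_supp oddvec_def)
  ultimately show ?thesis using signs_pm[OF assms(3), of m] by auto
qed

lemma dens_trivial:
  "oddvec N b \<Longrightarrow> card (supp b) = 1 \<Longrightarrow> dens N (insert b B) = dens N B"
  by (rule dens_cong) (auto simp: ok_def ok_trivial)

section \<open>Effect of a merge on a single vector: swap, cancel or double\<close>

lemma merge_zero: "b j = 0 \<Longrightarrow> merge i j c b = b"
  by (auto simp: merge_def)

lemma merge_swap:
  assumes "oddvec N b" "i \<noteq> j" "i < N" "c = 1 \<or> c = -1" "b i = 0 \<or> b j = 0"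
  shows "oddvec N (merge i j c b)" "card (supp (merge i j c b)) = card (supp b)"
proof -
  have fin: "finite (supp b)" using assms(1) by (rule oddvec_finite)
  have "oddvec N (merge i j c b) \<and> card (supp (merge i j c b)) = card (supp b)"
  proof (cases "b j = 0")
    case True then show ?thesis using assms(1) by (simp add: merge_zero)
  next
    case False
    then have bi: "b i = 0" using assms(5) by simp
    have s: "supp (merge i j c b) = insert i (supp b - {j})"
      using False assms(2,4) bi by (auto simp: supp_def merge_def)
    have c: "card (supp (merge i j c b)) = card (supp b)"
      unfolding s using fin bi False card_Suc_Diff1[of "supp b" j]
      by (subst card_insert_disjoint) (simp_all add: supp_def)
    have "merge i j c b l = 0 \<or> merge i j c b l = 1 \<or> merge i j c b l = -1" for l
      using assms(1,4) bi oddvec_pm[OF assms(1), of l] oddvec_pm[OF assms(1), of j]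
      by (cases "l = i"; cases "l = j"; cases "b l = 0") (auto simp: merge_def)
    moreover have "supp (merge i j c b) \<subseteq> {..<N}"
      using assms(1,3) s by (auto simp: oddvec_def)
    ultimately show ?thesis using c assms(1) by (simp add: oddvec_def)
  qed
  then show "oddvec N (merge i j c b)" "card (supp (merge i j c b)) = card (supp b)" by auto
qed

lemma merge_cancel:
  assumes "oddvec N b" "i \<noteq> j" "b j \<noteq> 0" "b i = - c * b j" "c = 1 \<or> c = -1"
  shows "oddvec N (merge i j c b)" "card (supp b) = card (supp (merge i j c b)) + 2"
    "supp (merge i j c b) = supp b - {i, j}"
proof -
  have fin: "finite (supp b)" using assms(1) by (rule oddvec_finite)
  show s: "supp (merge i j c b) = supp b - {i, j}"
    using assms by (auto simp: supp_def merge_def)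
  have "{i, j} \<subseteq> supp b" using assms by (auto simp: supp_def)
  then show c: "card (supp b) = card (supp (merge i j c b)) + 2"
    unfolding s using fin assms(2) card_mono[OF fin, of "{i,j}"] by (subst card_Diff_subset) auto
  have "odd (card (supp (merge i j c b)))" using assms(1) c by (auto simp: oddvec_def)
  moreover have "merge i j c b l = 0 \<or> merge i j c b l = 1 \<or> merge i j c b l = -1" for l
  proof -
    have "merge i j c b l = (if l = i \<or> l = j then 0 else b l)"
      by (simp add: merge_def assms(4))
    then show ?thesis using oddvec_pm[OF assms(1), of l] by auto
  qed
  moreover have "supp (merge i j c b) \<subseteq> {..<N}"
    using assms(1) s by (auto simp: oddvec_def)
  ultimately show "oddvec N (merge i j c b)"
    by (simp add: oddvec_def)
qed

lemma merge_double:
  assumes "oddvec N b" "i \<noteq> j" "b j \<noteq> 0" "b i = c * b j" "c = 1 \<or> c = -1"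
  shows "merge i j c b i = 2 \<or> merge i j c b i = -2" "i < N"
  using assms oddvec_pm[OF assms(1,3)] oddvec_less[OF assms(1), of i] by (auto simp: merge_def)

text \<open>In closed form this is binomial(2t+1, t) / 4^t, the probability that a sum of 2t+1
  independent random signs is 1 or -1. The recursion is the quotient of consecutive terms.\<close>

fun delta :: "nat \<Rightarrow> real" where
  "delta 0 = 1"
| "delta (Suc t) = (2 * real t + 3) / (2 * real t + 4) * delta t"

text \<open>On a balanced sign pattern the number of ordered pairs of opposite signs is constant,
  and merging such a pair shortens the vector by two entries.\<close>
lemma dens_single:
  "oddvec N b \<Longrightarrow> card (supp b) = 2 * t + 1 \<Longrightarrow> dens N {b} = delta t"
proof (induction t arbitrary: b)
  case 0
  then show ?case using dens_trivial[of N b "{}"] by (simp add: dens_empty)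
next
  case (Suc t)
  let ?T = "supp b"
  have fin: "finite ?T" using Suc.prems(1) by (rule oddvec_finite)
  have pm: "b i = 1 \<or> b i = -1" "i < N" if "i \<in> ?T" for i
    using that oddvec_pm[OF Suc.prems(1)] oddvec_less[OF Suc.prems(1)] by (auto simp: supp_def)
  \<comment> \<open>The first factor says that the signed terms \<open>b i * y i\<close> and
    \<open>b j * y j\<close> are opposite.\<close>
  let ?f = "\<lambda>i j y. of_bool (y j = (- (b i * b j)) * y i) * of_bool (ok N {b} y) :: real"
  have pair: "avg N (?f i j) = (if i = j then 0 else delta t / 2)" if ij: "i \<in> ?T" "j \<in> ?T" for i j
  proof (cases "i = j")
    case True
    have "avg N (?f i j) = avg N (\<lambda>y. 0)"
      using True pm[OF ij(1)] by (intro avg_cong) (auto dest: signs_pm)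
    then show ?thesis using True by (simp add: avg_def)
  next
    case False
    have b: "b j \<noteq> 0" "b i = - (- (b i * b j)) * b j" "- (b i * b j) = 1 \<or> - (b i * b j) = -1"
      using pm[OF ij(1)] pm[OF ij(2)] by auto
    have "dens N (merge i j (- (b i * b j)) ` {b}) = delta t"
      using Suc.IH[OF merge_cancel(1)[OF Suc.prems(1) False b]]
        merge_cancel(2)[OF Suc.prems(1) False b] Suc.prems(2) by simp
    then show ?thesis
      using avg_merge[OF False pm(2)[OF ij(1)] pm(2)[OF ij(2)] b(3), of "{b}"] False by simp
  qed
  \<comment> \<open>Among 2t+3 signs with sum 1 or -1, one sign occurs t+1 times and the other t+2
    times, so there are 2(t+1)(t+2) ordered pairs of opposite signs.\<close>
  have "2 * (real t + 1) * (real t + 2) * dens N {b} = avg N (\<lambda>y. \<Sum>i\<in>?T. \<Sum>j\<in>?T. ?f i j y)"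
    unfolding dens_def avg_cmult[symmetric]
  proof (rule avg_cong)
    fix y assume y: "y \<in> signs N"
    define z where "z i = b i * y i" for i
    have s: "dot N b y = (\<Sum>i\<in>?T. z i)"
      using Suc.prems(1) by (simp add: dot_supp oddvec_def z_def)
    have "(\<Sum>i\<in>?T. \<Sum>j\<in>?T. ?f i j y) =
          (\<Sum>i\<in>?T. \<Sum>j\<in>?T. (1 - z i * z j) / 2 * of_bool (ok N {b} y))"
    proof (intro sum.cong refl)
      fix i j assume ij: "i \<in> ?T" "j \<in> ?T"
      show "?f i j y = (1 - z i * z j) / 2 * of_bool (ok N {b} y)"
        using pm[OF ij(1)] pm[OF ij(2)] signs_pm[OF y pm(2)[OF ij(1)]] signs_pm[OF y pm(2)[OF ij(2)]]
        by (auto simp: z_def)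
    qed
    also have "\<dots> = ((real (card ?T))\<^sup>2 - (\<Sum>i\<in>?T. z i)\<^sup>2) / 2 * of_bool (ok N {b} y)"
      unfolding sum_distrib_right[symmetric] sum_divide_distrib[symmetric] sum_subtractf
        sum_distrib_left[symmetric]
      by (simp add: power2_eq_square)
    also have "\<dots> = 2 * (real t + 1) * (real t + 2) * of_bool (ok N {b} y)"
    proof (cases "ok N {b} y")
      case True
      then have "(\<Sum>i\<in>?T. z i)\<^sup>2 = 1" using s by (simp add: ok_def abs_square_eq_1)
      then show ?thesis by (simp add: Suc.prems(2) power2_eq_square algebra_simps)
    qed simp
    finally show "2 * (real t + 1) * (real t + 2) * of_bool (ok N {b} y)
      = (\<Sum>i\<in>?T. \<Sum>j\<in>?T. ?f i j y)" by simp
  qed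
  also have "\<dots> = (\<Sum>i\<in>?T. \<Sum>j\<in>?T. avg N (?f i j))"
    by (simp only: avg_sum)
  also have "\<dots> = (\<Sum>i\<in>?T. \<Sum>j\<in>?T. if i = j then 0 else delta t / 2)"
    using pair by (intro sum.cong refl) auto
  also have "\<dots> = (\<Sum>i\<in>?T. (2 * real t + 2) * (delta t / 2))"
  proof (intro sum.cong refl)
    fix i assume i: "i \<in> ?T"
    have "(\<Sum>j\<in>?T. if i = j then 0 else delta t / 2) = (\<Sum>j\<in>?T - {i}. delta t / 2)"
      using fin i by (subst sum.remove[of _ i]) (auto intro!: sum.cong)
    also have "\<dots> = (2 * real t + 2) * (delta t / 2)"
      using fin i Suc.prems(2) by simp
    finally show "(\<Sum>j\<in>?T. if i = j then 0 else delta t / 2) = (2 * real t + 2) * (delta t / 2)" .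
  qed
  also have "\<dots> = (2 * real t + 3) * (real t + 1) * delta t"
    using Suc.prems(2) by (simp add: algebra_simps)
  finally have "(real t + 1) * (2 * (real t + 2) * dens N {b}) = (real t + 1) * ((2 * real t + 3) * delta t)"
    by (simp only: mult_ac)
  moreover have "real t + 1 \<noteq> 0" by linarith
  ultimately have "2 * (real t + 2) * dens N {b} = (2 * real t + 3) * delta t"
    by (simp only: mult_cancel_left) simp
  then show ?case by (simp add: field_simps)
qed

lemma delta_pos: "delta t > 0"
  by (induction t) (auto intro!: mult_pos_pos divide_pos_pos)

lemma delta_mono: "s \<le> t \<Longrightarrow> delta t \<le> delta s"
proof (induction t rule: dec_induct)
  case (step n)
  have "(2 * real n + 3) / (2 * real n + 4) * delta n \<le> 1 * delta n"
    by (intro mult_right_mono) (auto simp: delta_pos less_imp_le)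
  with step show ?case by simp
qed simp

lemma delta_values: "delta 1 = 3/4" "delta 2 = 5/8" "delta 3 = 35/64" "delta 4 = 63/128"
  by (simp_all add: eval_nat_numeral)

lemma dens_single_le:
  assumes "oddvec N b" "2 * s + 1 \<le> card (supp b)" "b \<in> B"
  shows "dens N B \<le> delta s"
proof -
  obtain t where t: "card (supp b) = 2 * t + 1" using assms(1) by (auto simp: oddvec_def elim!: oddE)
  then have "dens N B \<le> delta t" using dens_single[OF assms(1) t] dens_antimono[of "{b}" B N] assms(3) by simp
  also have "\<dots> \<le> delta s" using t assms(2) by (intro delta_mono) simp
  finally show ?thesis .
qed

lemma dens_ge3: "oddvec N b \<Longrightarrow> 3 \<le> card (supp b) \<Longrightarrow> b \<in> B \<Longrightarrow> dens N B \<le> 3/4"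
  using dens_single_le[of N b 1 B] by (simp add: delta_values del: delta.simps One_nat_def)

lemma dens_ge5: "oddvec N b \<Longrightarrow> 5 \<le> card (supp b) \<Longrightarrow> b \<in> B \<Longrightarrow> dens N B \<le> 5/8"
  using dens_single_le[of N b 2 B] by (simp add: delta_values del: delta.simps)

lemma dens_eq3: "oddvec N b \<Longrightarrow> card (supp b) = 3 \<Longrightarrow> dens N {b} = 3/4"
  using dens_single[of N b 1] by (simp add: delta_values del: delta.simps One_nat_def)

section \<open>Pairs of vectors\<close>

text \<open>A merge either moves an entry to a free place, deletes two opposite contributions, or
  creates an entry 2 or -2. These cases respectively keep the support size, lower it by two, or push
  the density to at most 1/2.\<close>

lemma merge_cases:
  assumes "oddvec N b" "i \<noteq> j" "i < N" "c = 1 \<or> c = -1"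
  obtains (swap) "b i = 0 \<or> b j = 0" "oddvec N (merge i j c b)"
      "card (supp (merge i j c b)) = card (supp b)"
  | (cancel) "b i \<noteq> 0" "b j \<noteq> 0" "b i = - c * b j" "oddvec N (merge i j c b)"
      "card (supp b) = card (supp (merge i j c b)) + 2"
  | (double) "b i \<noteq> 0" "b j \<noteq> 0" "b i = c * b j" "merge i j c b i = 2 \<or> merge i j c b i = -2"
proof (cases "b i = 0 \<or> b j = 0")
  case True
  then show ?thesis using swap merge_swap[OF assms True] by blast
next
  case False
  then have nz: "b i \<noteq> 0" "b j \<noteq> 0" by auto
  then consider "b i = - c * b j" | "b i = c * b j"
    using oddvec_pm[OF assms(1) nz(1)] oddvec_pm[OF assms(1) nz(2)] assms(4) by auto
  then show ?thesis
  proof cases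
    case 1
    then show ?thesis
      using cancel merge_cancel(1,2)[OF assms(1,2) nz(2) _ assms(4)] nz by blast
  next
    case 2
    then show ?thesis
      using double merge_double(1)[OF assms(1,2) nz(2) _ assms(4)] nz by blast
  qed
qed

lemma dens_merge_double:
  assumes "oddvec N b" "b \<in> B" "i \<noteq> j" "b j \<noteq> 0" "b i = c * b j" "c = 1 \<or> c = -1"
  shows "dens N (merge i j c ` B) \<le> 1 / 2"
  using merge_double[OF assms(1,3-6)] assms(2)
  by (intro dens_big_entry_half[of "merge i j c b" _ i]) auto

lemma dens_merge_swap5:
  assumes "oddvec N b" "b \<in> B" "5 \<le> card (supp b)" "i \<noteq> j" "i < N" "c = 1 \<or> c = -1"
    "b i = 0 \<or> b j = 0"
  shows "dens N (merge i j c ` B) \<le> 5 / 8"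
  using merge_swap[OF assms(1,4-7)] assms(2,3) by (intro dens_ge5[of N "merge i j c b"]) auto

lemma dens_merge_swap3:
  assumes "oddvec N b" "b \<in> B" "3 \<le> card (supp b)" "i \<noteq> j" "i < N" "c = 1 \<or> c = -1"
    "b i = 0 \<or> b j = 0"
  shows "dens N (merge i j c ` B) \<le> 3 / 4"
  using merge_swap[OF assms(1,4-7)] assms(2,3) by (intro dens_ge3[of N "merge i j c b"]) auto

lemma dens_merge_ge5:
  assumes "oddvec N b" "b \<in> B" "5 \<le> card (supp b)" "i \<noteq> j" "i < N" "c = 1 \<or> c = -1"
  shows "dens N (merge i j c ` B) \<le> 3 / 4"
proof (rule merge_cases[OF assms(1,4-6)])
  assume "b i = 0 \<or> b j = 0"
  then show ?thesis using dens_merge_swap5[OF assms] by simp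
next
  assume "oddvec N (merge i j c b)" "card (supp b) = card (supp (merge i j c b)) + 2"
  then show ?thesis using assms(2,3) by (intro dens_ge3[of N "merge i j c b"]) auto
next
  assume "b j \<noteq> 0" "b i = c * b j"
  then show ?thesis using dens_merge_double[OF assms(1,2,4) _ _ assms(6)] by simp
qed

lemma oddvec_prod:
  assumes "oddvec N b" "b i \<noteq> 0" "b j \<noteq> 0"
  shows "b i * b j = 1 \<or> b i * b j = -1" "b i = b i * b j * b j"
  using oddvec_pm[OF assms(1,2)] oddvec_pm[OF assms(1,3)] by auto

text \<open>The relative signs of the two vectors at \<open>i\<close> and \<open>j\<close> are
  opposite, so whichever relation is imposed between \<open>y i\<close> and \<open>y j\<close>
  doubles an entry of one of them. Both branches of the split are therefore at most 1/2.\<close>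

lemma dens_mixed:
  assumes "oddvec N b" "oddvec N b'" "b \<in> B" "b' \<in> B" "i \<noteq> j"
    "b i \<noteq> 0" "b j \<noteq> 0" "b' i \<noteq> 0" "b' j \<noteq> 0" "b i * b j \<noteq> b' i * b' j"
  shows "dens N B \<le> 1 / 2"
proof -
  have c: "b i * b j = 1 \<or> b i * b j = -1" "b i = b i * b j * b j"
    using oddvec_prod[OF assms(1,6,7)] by auto
  have c': "b' i * b' j = - (b i * b j)" "b' i = b' i * b' j * b' j"
    using oddvec_prod[OF assms(2,8,9)] c(1) assms(10) by auto
  have "dens N (merge i j (b i * b j) ` B) \<le> 1/2"
    using dens_merge_double[OF assms(1,3,5,7) c(2,1)] .
  moreover have "dens N (merge i j (- (b i * b j)) ` B) \<le> 1/2"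
    using dens_merge_double[OF assms(2,4,5,9), of "- (b i * b j)"] c' c(1) by auto
  ultimately show ?thesis
    using dens_split[OF assms(5) oddvec_less[OF assms(1,6)] oddvec_less[OF assms(1,7)] c(1), of B]
    by simp
qed

text \<open>In one branch the entry of \<open>b'\<close> at \<open>i\<close> doubles where
  \<open>b\<close> vanishes, which leaves at most half of the density of \<open>b\<close>. In the
  other branch the two entries of \<open>b'\<close> cancel and \<open>b\<close> is
  untouched.\<close>

lemma dens_two_outside:
  assumes "oddvec N b'" "i \<noteq> j" "b i = 0" "b j = 0" "b' i \<noteq> 0" "b' j \<noteq> 0"
  shows "dens N {b, b'} \<le> dens N {b, merge i j (- (b' i * b' j)) b'} / 2 + dens N {b} / 4"
proof -
  let ?c = "b' i * b' j"
  have c: "?c = 1 \<or> ?c = -1" "b' i = ?c * b' j"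
    using oddvec_prod[OF assms(1,5,6)] by auto
  have lt: "i < N" "j < N" using oddvec_less[OF assms(1)] assms(5,6) by auto
  have "dens N {merge i j ?c b', b} \<le> dens N {b} / 2"
    using merge_double[OF assms(1,2,6) c(2,1)] assms(3)
    by (intro dens_big_entry[of i]) auto
  moreover have "merge i j ?c ` {b, b'} = {merge i j ?c b', b}"
    "merge i j (- ?c) ` {b, b'} = {b, merge i j (- ?c) b'}"
    using assms(4) by (auto simp: merge_zero)
  ultimately show ?thesis
    using dens_split[OF assms(2) lt c(1), of "{b, b'}"] by (simp add: field_simps)
qed

lemma dens_two_outside_le:
  assumes "oddvec N b" "oddvec N b'" "2 \<le> card (supp b' - supp b)"
  shows "dens N {b, b'} \<le> 3 / 4 * dens N {b}"
proof -
  obtain S where "S \<subseteq> supp b' - supp b" "card S = 2"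
    using assms(3) by (meson obtain_subset_with_card_n)
  then obtain i j where ij: "i \<noteq> j" "i \<in> supp b' - supp b" "j \<in> supp b' - supp b"
    by (auto simp: card_2_iff)
  have "dens N {b, b'} \<le> dens N {b, merge i j (- (b' i * b' j)) b'} / 2 + dens N {b} / 4"
    using ij by (intro dens_two_outside[OF assms(2)]) (auto simp: supp_def)
  moreover have "dens N {b, merge i j (- (b' i * b' j)) b'} \<le> dens N {b}"
    by (rule dens_antimono) simp
  ultimately show ?thesis by simp
qed

text \<open>If three signs sum to 1 or -1, exactly two of the three pairs are opposite. Hence twice
  the indicator of \<open>ok\<close> is the sum of three conditioned indicators, each averaging to
  half of a merged density. Each merge reduces \<open>b\<close> to a single entry.\<close>

lemma dens_three:
  assumes "oddvec N b" "b \<in> B" "supp b = {i, j, k}" "i \<noteq> j" "i \<noteq> k" "j \<noteq> k"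
  shows "4 * dens N B = dens N (merge i j (- (b i * b j)) ` B) +
    dens N (merge i k (- (b i * b k)) ` B) + dens N (merge j k (- (b j * b k)) ` B)"
proof -
  have nz: "b i \<noteq> 0" "b j \<noteq> 0" "b k \<noteq> 0" using assms(3) by (auto simp: supp_def)
  have lt: "i < N" "j < N" "k < N" using nz assms(1) oddvec_less by auto
  note pm = nz[THEN oddvec_pm[OF assms(1)]]
  let ?f = "\<lambda>i j y. of_bool (y j = (- (b i * b j)) * y i) * of_bool (ok N B y) :: real"
  have f: "avg N (?f i j) = dens N (merge i j (- (b i * b j)) ` B) / 2"
    "avg N (?f i k) = dens N (merge i k (- (b i * b k)) ` B) / 2"
    "avg N (?f j k) = dens N (merge j k (- (b j * b k)) ` B) / 2"
    using avg_merge[OF assms(4) lt(1,2), of "- (b i * b j)" B] avg_merge[OF assms(5) lt(1,3), of "- (b i * b k)" B]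
      avg_merge[OF assms(6) lt(2,3), of "- (b j * b k)" B] pm by auto
  have "2 * dens N B = avg N (\<lambda>y. (?f i j y + ?f i k y) + ?f j k y)"
    unfolding dens_def avg_cmult[symmetric]
  proof (rule avg_cong)
    fix y assume y: "y \<in> signs N"
    have d: "dot N b y = b i * y i + (b j * y j + b k * y k)"
      using assms by (simp add: dot_supp oddvec_def)
    have "ok N B y \<Longrightarrow> \<bar>dot N b y\<bar> = 1" using assms(2) by (auto simp: ok_def)
    then show "2 * of_bool (ok N B y) = (?f i j y + ?f i k y) + ?f j k y"
      unfolding d using pm lt[THEN signs_pm[OF y]]
      by (cases "ok N B y") (elim disjE; simp)+
  qed
  also have "\<dots> = avg N (?f i j) + avg N (?f i k) + avg N (?f j k)"
    by (simp only: avg_add)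
  finally show ?thesis unfolding f by simp
qed

lemma card_supp_3:
  assumes "card (supp b) = 3" "k \<in> supp b"
  obtains i j where "supp b = {i, j, k}" "i \<noteq> j" "i \<noteq> k" "j \<noteq> k"
proof -
  have "finite (supp b)" using assms(1) by (simp add: card_ge_0_finite)
  then have "card (supp b - {k}) = 2" using assms by simp
  then obtain i j where "supp b - {k} = {i, j}" "i \<noteq> j" by (auto simp: card_2_iff)
  then show ?thesis using that[of i j] assms(2) by blast
qed

section \<open>Vectors up to sign\<close>

definition pm_eq :: "(nat \<Rightarrow> real) \<Rightarrow> (nat \<Rightarrow> real) \<Rightarrow> bool" where
  "pm_eq b b' \<longleftrightarrow> b' = b \<or> b' = (\<lambda>i. - b i)"

lemma pm_eq_sym: "pm_eq b b' \<Longrightarrow> pm_eq b' b"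
  by (auto simp: pm_eq_def)

lemma pm_eqI:
  assumes "\<And>i. b' i = e * b i" "e = 1 \<or> e = -1"
  shows "pm_eq b b'"
  using assms by (auto simp: pm_eq_def fun_eq_iff)

lemma dens_pm_eq: "pm_eq b b' \<Longrightarrow> dens N (insert b (insert b' B)) = dens N (insert b B)"
  by (rule dens_cong) (auto simp: ok_def pm_eq_def dot_neg)

text \<open>Above density 1/2, \<open>dens_mixed\<close> forbids different relative signs on any two
  common positions. The sign observed at one common position therefore holds on the whole
  overlap.\<close>

lemma consistent_overlap:
  assumes "oddvec N b" "oddvec N b'" "b \<in> B" "b' \<in> B" "1 / 2 < dens N B"
  obtains e where "e = 1 \<or> e = (-1::real)" "\<And>i. b i \<noteq> 0 \<Longrightarrow> b' i \<noteq> 0 \<Longrightarrow> b' i = e * b i"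
proof (cases "\<exists>p. b p \<noteq> 0 \<and> b' p \<noteq> 0")
  case False
  \<comment> \<open>With disjoint supports the claim is vacuous and either sign would do.\<close>
  then show ?thesis using that[of 1] by auto
next
  case True
  then obtain p where p: "b p \<noteq> 0" "b' p \<noteq> 0" by auto
  note pm = oddvec_pm[OF assms(1) p(1)] oddvec_pm[OF assms(2) p(2)]
  show ?thesis
  proof (rule that[of "b p * b' p"])
    show "b p * b' p = 1 \<or> b p * b' p = - 1" using pm by auto
    fix i assume i: "b i \<noteq> 0" "b' i \<noteq> 0"
    have "i = p \<or> b i * b p = b' i * b' p"
      using dens_mixed[OF assms(1-4), of i p] i p assms(5) by force
    then show "b' i = b p * b' p * b i"
      using pm oddvec_pm[OF assms(1) i(1)] oddvec_pm[OF assms(2) i(2)] by auto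
  qed
qed

text \<open>Up to the global sign \<open>e\<close>, the vectors differ in one entry. Merging
  \<open>i\<close> into another support position \<open>j\<close> always doubles one vector at
  \<open>j\<close> and cancels the other there, leaving it at least three entries. Each branch is at
  most 1/2 times 3/4.\<close>

lemma dens_one_flipped:
  assumes "oddvec N b" "5 \<le> card (supp b)" "b i \<noteq> 0" "e = 1 \<or> e = (-1::real)"
    "b' = (\<lambda>l. if l = i then - e * b i else e * b l)"
  shows "dens N {b, b'} \<le> 3 / 8"
proof -
  have "supp b - {i} \<noteq> {}"
    using assms(2) card_mono[of "{i}" "supp b"] by auto
  then obtain j where j: "b j \<noteq> 0" "j \<noteq> i" by (auto simp: supp_def)
  have lt: "i < N" "j < N" using oddvec_less[OF assms(1)] assms(3) j by auto
  let ?c = "b j * b i"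
  have c: "?c = 1 \<or> ?c = -1" "b j = ?c * b i" using oddvec_prod[OF assms(1) j(1) assms(3)] by auto
  have s: "supp b' = supp b" using assms(3-5) by (auto simp: supp_def)
  have b': "oddvec N b'"
    using assms(1,4) s unfolding oddvec_def assms(5) by auto
  have bb: "b' i = - e * b i" "b' j = e * b j" using assms(5) j by auto
  have one: "dens N {u, v} \<le> 3/8" if uv: "u j \<noteq> 0" "u j \<noteq> 1" "u j \<noteq> -1" "v j = 0"
    "oddvec N v" "3 \<le> card (supp v)" for u v
  proof -
    have "dens N {u, v} \<le> dens N {v} / 2" using uv lt by (intro dens_big_entry[of j]) auto
    moreover have "dens N {v} \<le> 3/4" using uv by (intro dens_ge3[of N v]) auto
    ultimately show ?thesis by simp
  qed
  have cb': "b' j = - ?c * b' i" using bb c by (auto simp: algebra_simps)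
  have nb': "b' i \<noteq> 0" using bb assms(3,4) by auto
  have "dens N {merge j i ?c b, merge j i ?c b'} \<le> 3/8"
  proof (rule one)
    show "merge j i ?c b' j = 0" by (simp add: merge_def cb')
    show "3 \<le> card (supp (merge j i ?c b'))"
      using merge_cancel(2)[OF b' j(2) nb' cb' c(1)] assms(2) s by simp
  qed (use merge_double(1)[OF assms(1) j(2) assms(3) c(2,1)] merge_cancel(1)[OF b' j(2) nb' cb' c(1)] in auto)
  moreover have "dens N {merge j i (- ?c) b', merge j i (- ?c) b} \<le> 3/8"
  proof (rule one)
    have m: "b j = - (- ?c) * b i" "- ?c = 1 \<or> - ?c = -1" using c by auto
    show "merge j i (- ?c) b j = 0" using c(2) by (simp add: merge_def)
    show "3 \<le> card (supp (merge j i (- ?c) b))"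
      using merge_cancel(2)[OF assms(1) j(2) assms(3) m] assms(2) by simp
    show "oddvec N (merge j i (- ?c) b)" by (rule merge_cancel(1)[OF assms(1) j(2) assms(3) m])
    have "merge j i (- ?c) b' j = 2 \<or> merge j i (- ?c) b' j = -2"
      by (rule merge_double(1)[OF b' j(2) nb' cb' m(2)])
    then show "merge j i (- ?c) b' j \<noteq> 0" "merge j i (- ?c) b' j \<noteq> 1" "merge j i (- ?c) b' j \<noteq> -1"
      by auto
  qed
  ultimately show ?thesis
    using dens_split[OF j(2) lt(2,1) c(1), of "{b, b'}"] by (simp add: insert_commute)
qed

text \<open>Two positions of one vector outside the other would give at most 3/4 * 5/8 = 15/32. So
  each support has at most one position of its own. If there is one on each side, merging these two
  yields the branches 5/8 and 3/8, whose mean is 1/2.\<close>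

lemma dens_pair_ge5:
  assumes b: "oddvec N b" "5 \<le> card (supp b)" and b': "oddvec N b'" "5 \<le> card (supp b')"
    and ne: "\<not> pm_eq b b'"
  shows "dens N {b, b'} \<le> 1 / 2"
proof (rule ccontr)
  let ?T = "supp b" and ?T' = "supp b'"
  assume "\<not> ?thesis"
  then have gt: "1/2 < dens N {b, b'}" by simp
  have fin: "finite ?T" "finite ?T'" using b b' oddvec_finite by auto
  have "card (?T' - ?T) \<le> 1"
    using dens_two_outside_le[OF b(1) b'(1)] dens_ge5[OF b, of "{b}"] gt by fastforce
  moreover have "card (?T - ?T') \<le> 1"
    using dens_two_outside_le[OF b'(1) b(1)] dens_ge5[OF b', of "{b'}"] gt
    by (fastforce simp: insert_commute)
  moreover have "card ?T = card (?T \<inter> ?T') + card (?T - ?T')"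
    "card ?T' = card (?T \<inter> ?T') + card (?T' - ?T)"
    using fin card_Int_Diff[of ?T ?T'] card_Int_Diff[of ?T' ?T] by (auto simp: Int_commute)
  moreover have "odd (card ?T)" "odd (card ?T')" using b b' by (auto simp: oddvec_def)
  \<comment> \<open>Both supports are odd and share their intersection, so the two differences have
    equal parity; being at most 1, they are equal.\<close>
  moreover have "x = y" if "y \<le> 1" "x \<le> 1" "a = c + x" "a' = c + y" "odd a" "odd a'"
    for a a' c x y :: nat
    using that by presburger
  ultimately have d: "card (?T - ?T') = card (?T' - ?T)" "card (?T - ?T') \<le> 1"
    by blast+
  obtain e where e: "e = 1 \<or> e = -1" "\<And>i. b i \<noteq> 0 \<Longrightarrow> b' i \<noteq> 0 \<Longrightarrow> b' i = e * b i"
    using consistent_overlap[OF b(1) b'(1) _ _ gt] by auto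
  show False
  proof (cases "card (?T - ?T') = 0")
    case True
    then have "?T - ?T' = {}" "?T' - ?T = {}" using d fin by (metis card_0_eq finite_Diff)+
    then have "b' i = e * b i" for i
      using e(2)[of i] by (cases "b i = 0"; cases "b' i = 0") (auto simp: supp_def)
    then show False using ne e(1) pm_eqI by blast
  next
    case False
    then have "card (?T - ?T') = 1" "card (?T' - ?T) = 1" using d by auto
    then obtain i j where ij: "?T - ?T' = {i}" "?T' - ?T = {j}" by (auto simp: card_1_singleton_iff)
    have nz: "b i \<noteq> 0" "b' i = 0" "b j = 0" "b' j \<noteq> 0" "i \<noteq> j" using ij by (auto simp: supp_def)
    have lt: "i < N" "j < N" using nz b(1) b'(1) oddvec_less by auto
    have ov: "b' l = e * b l" if "l \<noteq> i" "l \<noteq> j" for l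
    proof -
      have "l \<in> ?T \<longleftrightarrow> l \<in> ?T'" using ij that by blast
      then show ?thesis using e(2)[of l] by (cases "b l = 0") (auto simp: supp_def)
    qed
    \<comment> \<open>This sign moves the private entry of \<open>b'\<close> from \<open>j\<close>
      to \<open>i\<close> with value \<open>e * b i\<close>, so the merged vector is
      \<open>b\<close> up to sign; the opposite choice differs from that only at
      \<open>i\<close>.\<close>
    let ?c = "e * b i * b' j"
    have pm: "b i = 1 \<or> b i = -1" "b' j = 1 \<or> b' j = -1"
      using nz oddvec_pm[OF b(1)] oddvec_pm[OF b'(1)] by auto
    have c: "?c = 1 \<or> ?c = -1" using e(1) pm by auto
    have m: "merge i j (s * ?c) b' = (\<lambda>l. if l = i then s * e * b i else e * b l)" for s
      using nz pm ov by (auto simp: merge_def fun_eq_iff)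
    have m': "merge i j (- ?c) b' = (\<lambda>l. if l = i then - e * b i else e * b l)"
      using m[of "-1"] by (simp only: mult_minus1)
    have "pm_eq b (merge i j ?c b')"
      using m[of 1] e(1) by (intro pm_eqI[of _ e]) auto
    then have "dens N (merge i j ?c ` {b, b'}) \<le> 5/8"
      using dens_pm_eq[of b "merge i j ?c b'" N "{}"] dens_ge5[OF b, of "{b}"] nz
      by (simp add: merge_zero)
    moreover have "dens N (merge i j (- ?c) ` {b, b'}) \<le> 3/8"
      using dens_one_flipped[OF b nz(1) e(1) m'] nz
      by (simp add: merge_zero)
    ultimately show False using dens_split[OF nz(5) lt c, of "{b, b'}"] gt by simp
  qed
qed

text \<open>At least two positions of \<open>b'\<close> lie outside the triple, so the bound is 3/4
  * 3/4.\<close>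

lemma dens_3_ge5_le:
  assumes "oddvec N b" "card (supp b) = 3" "oddvec N b'" "5 \<le> card (supp b')"
  shows "dens N {b, b'} \<le> 9 / 16"
proof -
  have "2 \<le> card (supp b' - supp b)"
    using assms diff_card_le_card_Diff[of "supp b" "supp b'"] oddvec_finite[OF assms(1)] by simp
  then show ?thesis
    using dens_two_outside_le[OF assms(1,3)] dens_eq3[OF assms(1,2)] by simp
qed

text \<open>If the triple has a position outside \<open>supp b'\<close>, two of its three merges
  keep all entries of \<open>b'\<close>, and (3/4 + 5/8 + 5/8) / 4 = 1/2. Otherwise
  \<open>b'\<close> has at least seven entries, and two of them outside the triple give at most 9/32
  + 3/16 = 15/32.\<close>

lemma dens_3_ge5_half:
  assumes b: "oddvec N b" "card (supp b) = 3" and b': "oddvec N b'" "5 \<le> card (supp b')"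
    and ns: "\<not> (supp b \<subseteq> supp b' \<and> card (supp b') = 5)"
  shows "dens N {b, b'} \<le> 1 / 2"
proof (cases "supp b \<subseteq> supp b'")
  case False
  then obtain k where k: "k \<in> supp b" "b' k = 0" by (auto simp: supp_def)
  obtain i j where ij: "supp b = {i, j, k}" "i \<noteq> j" "i \<noteq> k" "j \<noteq> k"
    using card_supp_3[OF b(2) k(1)] by blast
  have nz: "b i \<noteq> 0" "b j \<noteq> 0" "b k \<noteq> 0" using ij(1) by (auto simp: supp_def)
  have lt: "i < N" "j < N" "k < N" using nz b(1) oddvec_less by auto
  note pm = nz[THEN oddvec_pm[OF b(1)]]
  have "dens N (merge i j (- (b i * b j)) ` {b, b'}) \<le> 3/4"
    using b' ij lt pm by (intro dens_merge_ge5[of N b']) auto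
  moreover have "dens N (merge i k (- (b i * b k)) ` {b, b'}) \<le> 5/8"
    using b' ij lt pm k by (intro dens_merge_swap5[of N b']) auto
  moreover have "dens N (merge j k (- (b j * b k)) ` {b, b'}) \<le> 5/8"
    using b' ij lt pm k by (intro dens_merge_swap5[of N b']) auto
  ultimately show ?thesis using dens_three[OF b(1) _ ij, of "{b, b'}"] by simp
next
  case True
  then have "card (supp b') \<noteq> 5" using ns by simp
  then have c7: "7 \<le> card (supp b')" using b' by (auto simp: oddvec_def elim!: oddE)
  then have "2 \<le> card (supp b' - supp b)"
    using b diff_card_le_card_Diff[of "supp b" "supp b'"] oddvec_finite[OF b(1)] by simp
  then obtain S where "S \<subseteq> supp b' - supp b" "card S = 2"
    by (meson obtain_subset_with_card_n)
  then obtain i j where ij: "i \<noteq> j" "i \<in> supp b' - supp b" "j \<in> supp b' - supp b"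
    by (auto simp: card_2_iff)
  let ?m = "merge i j (- (b' i * b' j)) b'"
  have nz: "b' i \<noteq> 0" "b' j \<noteq> 0" using ij by (auto simp: supp_def)
  have c: "b' i = - (- (b' i * b' j)) * b' j" "- (b' i * b' j) = 1 \<or> - (b' i * b' j) = -1"
    using oddvec_prod[OF b'(1) nz] by auto
  have "dens N {b, b'} \<le> dens N {b, ?m} / 2 + dens N {b} / 4"
    using ij by (intro dens_two_outside[OF b'(1)]) (auto simp: supp_def)
  moreover have "dens N {b, ?m} \<le> 9/16"
    using merge_cancel(1,2)[OF b'(1) ij(1) nz(2) c] c7 by (intro dens_3_ge5_le[OF b]) auto
  ultimately show ?thesis using dens_eq3[OF b] by simp
qed

text \<open>With a position of \<open>b\<close> outside \<open>supp b'\<close>, two of the three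
  merges leave \<open>b'\<close> a triple, so the bound is (1 + 3/4 + 3/4) / 4.\<close>

lemma dens_3_3_le:
  assumes b: "oddvec N b" "card (supp b) = 3" and b': "oddvec N b'" "card (supp b') = 3"
    and ne: "\<not> pm_eq b b'"
  shows "dens N {b, b'} \<le> 5 / 8"
proof (rule ccontr)
  let ?T = "supp b" and ?T' = "supp b'"
  assume "\<not> ?thesis"
  then have gt: "5/8 < dens N {b, b'}" by simp
  then have gt2: "1/2 < dens N {b, b'}" by simp
  have fin: "finite ?T" "finite ?T'" using b b' oddvec_finite by auto
  obtain e where e: "e = 1 \<or> e = -1" "\<And>i. b i \<noteq> 0 \<Longrightarrow> b' i \<noteq> 0 \<Longrightarrow> b' i = e * b i"
    using consistent_overlap[OF b(1) b'(1) _ _ gt2] by auto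
  show False
  proof (cases "?T \<subseteq> ?T'")
    case True
    then have "?T = ?T'" using b b' fin by (intro card_subset_eq) auto
    then have "b' i = e * b i" for i
      using e(2)[of i] by (cases "b i = 0"; cases "b' i = 0") (auto simp: supp_def)
    then show False using ne e(1) pm_eqI by blast
  next
    case False
    then obtain k where k: "k \<in> supp b" "b' k = 0" by (auto simp: supp_def)
    obtain i j where ij: "supp b = {i, j, k}" "i \<noteq> j" "i \<noteq> k" "j \<noteq> k"
      using card_supp_3[OF b(2) k(1)] by blast
    have nz: "b i \<noteq> 0" "b j \<noteq> 0" "b k \<noteq> 0" using ij(1) by (auto simp: supp_def)
    have lt: "i < N" "j < N" "k < N" using nz b(1) oddvec_less by auto
    note pm = nz[THEN oddvec_pm[OF b(1)]]
    have "dens N (merge i k (- (b i * b k)) ` {b, b'}) \<le> 3/4"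
      using b' ij lt pm k by (intro dens_merge_swap3[of N b']) auto
    moreover have "dens N (merge j k (- (b j * b k)) ` {b, b'}) \<le> 3/4"
      using b' ij lt pm k by (intro dens_merge_swap3[of N b']) auto
    ultimately show False
      using gt dens_three[OF b(1) _ ij, of "{b, b'}"]
        dens_le_1[of N "merge i j (- (b i * b j)) ` {b, b'}"] by simp
  qed
qed

lemma oddvec_card_3: "oddvec N b \<Longrightarrow> 3 \<le> card (supp b) \<Longrightarrow> card (supp b) = 3 \<or> 5 \<le> card (supp b)"
  by (auto simp: oddvec_def elim!: oddE)

lemma dens_pair_le:
  assumes b: "oddvec N b" "3 \<le> card (supp b)" and b': "oddvec N b'" "3 \<le> card (supp b')"
    and ne: "\<not> pm_eq b b'"
  shows "dens N {b, b'} \<le> 5 / 8"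
  using oddvec_card_3[OF b] oddvec_card_3[OF b'] dens_ge5[OF b(1), of "{b, b'}"]
    dens_ge5[OF b'(1), of "{b, b'}"] dens_3_3_le[OF b(1) _ b'(1) _ ne] by auto

text \<open>Each merge along the triple makes \<open>b\<close> trivial and turns \<open>b'\<close>
  into a triple of density 3/4, so the three summands total 9/4.\<close>

lemma dens_pair_eq_9_16:
  assumes b: "oddvec N b" "supp b = {i, j, k}" "i \<noteq> j" "i \<noteq> k" "j \<noteq> k"
    and m: "\<And>i j. b i \<noteq> 0 \<Longrightarrow> b j \<noteq> 0 \<Longrightarrow> i \<noteq> j \<Longrightarrow> oddvec N (merge i j (- (b i * b j)) b') \<and>
       card (supp (merge i j (- (b i * b j)) b')) = 3"
  shows "dens N {b, b'} = 9 / 16"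
proof -
  have one: "dens N (merge i j (- (b i * b j)) ` {b, b'}) = 3/4"
    if nz: "b i \<noteq> 0" "b j \<noteq> 0" "i \<noteq> j" for i j
  proof -
    have c: "b i = - (- (b i * b j)) * b j" "- (b i * b j) = 1 \<or> - (b i * b j) = -1"
      using oddvec_prod[OF b(1) nz(1,2)] by auto
    show ?thesis
      using dens_eq3 m[OF nz] dens_trivial[OF merge_cancel(1)[OF b(1) nz(3,2) c]]
        merge_cancel(2)[OF b(1) nz(3,2) c] b by simp
  qed
  have "b i \<noteq> 0" "b j \<noteq> 0" "b k \<noteq> 0" using b(2) by (auto simp: supp_def)
  then show ?thesis
    using dens_three[OF b(1) _ b(2-5), of "{b, b'}"] one[OF _ _ b(3)] one[OF _ _ b(4)] one[OF _ _ b(5)]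
    by simp
qed

section \<open>Stars and triples of vectors\<close>

text \<open>The signs at the positions in \<open>K\<close> are independent relative to the sign at
  \<open>i\<close>, and each equation costs a factor of one half.\<close>

lemma avg_forced:
  assumes "finite K" "K \<subseteq> {..<N}" "i \<notin> K" "i < N" "\<And>k. k \<in> K \<Longrightarrow> c k = 1 \<or> c k = -1"
  shows "avg N (\<lambda>y. of_bool (\<forall>k\<in>K. y k = c k * y i)) = 1 / 2 ^ card K"
  using assms
proof (induction K rule: finite_induct)
  case empty
  then show ?case by (simp add: avg_one)
next
  case (insert k K)
  let ?f = "\<lambda>y. of_bool (\<forall>k\<in>K. y k = c k * y i) :: real"
  have "avg N (\<lambda>y. of_bool (\<forall>k\<in>insert k K. y k = c k * y i)) =
        avg N (\<lambda>y. of_bool (y k = c k * y i) * ?f y)"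
    by (rule avg_cong) auto
  also have "\<dots> = avg N ?f / 2"
  proof (rule avg_half)
    show "?f (flip k y) = ?f y" for y
      using insert.hyps(2) insert.prems(2)
      by (intro arg_cong[where f = of_bool] ball_cong refl) (auto simp: flip_def)
  qed (use insert.prems in auto)
  finally show ?case using insert by simp
qed

definition star :: "nat \<Rightarrow> nat \<Rightarrow> real \<Rightarrow> (nat \<Rightarrow> real) \<Rightarrow> bool" where
  "star i j c b \<longleftrightarrow> b j \<noteq> 0 \<and> b i = c * b j \<and> card (supp b) = 3"

lemma star_supp:
  assumes "star i j c b" "i \<noteq> j" "c = 1 \<or> c = -1"
  obtains k where "supp b = {i, j, k}" "k \<noteq> i" "k \<noteq> j"
proof -
  have ij: "i \<in> supp b" "j \<in> supp b" "card (supp b) = 3"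
    using assms by (auto simp: star_def supp_def)
  obtain p q where "supp b = {p, q, j}" "p \<noteq> q" "p \<noteq> j" "q \<noteq> j"
    using card_supp_3[OF ij(3,2)] by blast
  then show ?thesis using that[of p] that[of q] ij(1) assms(2) by auto
qed

text \<open>Either the entries at the two common positions cancel, and then every member is satisfied,
  or they add up, and then each remaining position is forced.\<close>
lemma dens_star:
  assumes ij: "i \<noteq> j" "i < N" "j < N" and c: "c = 1 \<or> c = -1"
    and F: "\<And>b. b \<in> F \<Longrightarrow> oddvec N b" "\<And>b. b \<in> F \<Longrightarrow> star i j c b"
    and cons: "\<And>b b' k. b \<in> F \<Longrightarrow> b' \<in> F \<Longrightarrow> k \<notin> {i, j} \<Longrightarrow> b k \<noteq> 0 \<Longrightarrow> b' k \<noteq> 0 \<Longrightarrow>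
        b i * b k = b' i * b' k"
  shows "dens N F = 1 / 2 + 1 / 2 ^ (card (\<Union> (supp ` F) - {i, j}) + 1)"
proof -
  let ?K = "\<Union> (supp ` F) - {i, j}"
  have K: "?K \<subseteq> {..<N}" using F(1) by (auto simp: oddvec_def)
  then have fin: "finite ?K" by (rule finite_subset) simp
  have nz: "b i \<noteq> 0" "b j \<noteq> 0" if "b \<in> F" for b
    using F(2)[OF that] c by (auto simp: star_def)
  have "\<exists>v. (v = 1 \<or> v = -1) \<and> (\<forall>b\<in>F. b k \<noteq> 0 \<longrightarrow> v = - (b i * b k))" if k: "k \<in> ?K" for k
  proof -
    obtain b where b: "b \<in> F" "b k \<noteq> 0" using k by (auto simp: supp_def)
    show ?thesis
    proof (rule exI[of _ "- (b i * b k)"], intro conjI ballI impI)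
      show "- (b i * b k) = 1 \<or> - (b i * b k) = - 1"
        using oddvec_prod(1)[OF F(1)[OF b(1)] nz(1)[OF b(1)] b(2)] by auto
      fix b' assume "b' \<in> F" "b' k \<noteq> 0"
      then show "- (b i * b k) = - (b' i * b' k)" using cons[OF b(1) _ _ b(2)] k by auto
    qed
  qed
  \<comment> \<open>When the entries at \<open>i\<close> and \<open>j\<close> add up, a member with
    third position \<open>k\<close> holds only if its term there is opposite to the one at
    \<open>i\<close>. Consistency makes the forced relative sign the same for all members through
    \<open>k\<close>.\<close>
  then obtain e where e: "\<And>k. k \<in> ?K \<Longrightarrow> e k = 1 \<or> e k = -1"
    "\<And>k b. k \<in> ?K \<Longrightarrow> b \<in> F \<Longrightarrow> b k \<noteq> 0 \<Longrightarrow> e k = - (b i * b k)"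
    by metis
  \<comment> \<open>The relation defining the second branch is recorded as one more forced sign, so
    that \<open>avg_forced\<close> counts the whole branch at once.\<close>
  define e' where "e' = e(j := c)"
  let ?C = "\<lambda>y. \<forall>k\<in>insert j ?K. y k = e' k * y i"
  have "dens N F = avg N (\<lambda>y. of_bool (y j = (- c) * y i) * 1 + of_bool (?C y))"
    unfolding dens_def
  proof (rule avg_cong)
    fix y assume y: "y \<in> signs N"
    note yi = signs_pm[OF y ij(2)] and yj = signs_pm[OF y ij(3)]
    have tip: "\<bar>dot N b y\<bar> = 1 \<longleftrightarrow> y j = - c * y i \<or> (y j = c * y i \<and> (\<forall>k\<in>?K. b k \<noteq> 0 \<longrightarrow> y k = e k * y i))"
      if b: "b \<in> F" for b
    proof -
      obtain k where k: "supp b = {i, j, k}" "k \<noteq> i" "k \<noteq> j"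
        using star_supp[OF F(2)[OF b] ij(1) c] by blast
      have kK: "k \<in> ?K" using k b by blast
      have bk: "b k \<noteq> 0" using k by (auto simp: supp_def)
      have kN: "k < N" using oddvec_less[OF F(1)[OF b] bk] .
      have ek: "e k = - (b i * b k)" using e(2)[OF kK b bk] .
      have bi: "b i = c * b j" using F(2)[OF b] by (simp add: star_def)
      have only: "(\<forall>l\<in>?K. b l \<noteq> 0 \<longrightarrow> y l = e l * y i) \<longleftrightarrow> y k = e k * y i"
      proof -
        have "l = k" if "l \<in> ?K" "b l \<noteq> 0" for l
        proof -
          have "l \<in> supp b" using that by (simp add: supp_def)
          then show ?thesis using that k by auto
        qed
        then show ?thesis using kK bk by blast
      qed
      have d: "dot N b y = b i * y i + (b j * y j + b k * y k)"
        using k ij(1) F(1)[OF b] by (simp add: dot_supp oddvec_def)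
      show ?thesis
        unfolding only d ek bi
        using yi yj signs_pm[OF y kN] c oddvec_pm[OF F(1)[OF b] bk]
          oddvec_pm[OF F(1)[OF b] nz(2)[OF b]]
        by (elim disjE) simp_all
    qed
    have "ok N F y \<longleftrightarrow> y j = - c * y i \<or> ?C y"
    proof
      assume okF: "ok N F y"
      show "y j = - c * y i \<or> ?C y"
      proof (cases "y j = - c * y i")
        case ne: False
        then have yjc: "y j = c * y i" using yi yj c by auto
        have "y k = e k * y i" if k: "k \<in> ?K" for k
        proof -
          obtain b where b: "b \<in> F" "b k \<noteq> 0" using k by (auto simp: supp_def)
          have "\<bar>dot N b y\<bar> = 1" using okF b(1) by (simp add: ok_def)
          then show ?thesis using tip[OF b(1)] ne k b(2) by blast
        qed
        then show ?thesis using yjc by (auto simp: e'_def)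
      qed simp
    next
      assume h: "y j = - c * y i \<or> ?C y"
      show "ok N F y"
        unfolding ok_def
      proof
        fix b assume b: "b \<in> F"
        have "y j = c * y i \<and> (\<forall>k\<in>?K. b k \<noteq> 0 \<longrightarrow> y k = e k * y i)" if "?C y"
          using that by (auto simp: e'_def)
        then show "\<bar>dot N b y\<bar> = 1" using h tip[OF b] by blast
      qed
    qed
    moreover have "\<not> (y j = - c * y i \<and> ?C y)" using yi yj c by (auto simp: e'_def)
    ultimately show "of_bool (ok N F y) = of_bool (y j = (- c) * y i) * 1 + (of_bool (?C y) :: real)"
      by auto
  qed
  also have "\<dots> = 1 / 2 + 1 / 2 ^ card (insert j ?K)"
  proof -
    have "avg N (\<lambda>y. of_bool (y j = (- c) * y i) * 1) = 1 / 2"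
      using avg_half[OF ij, of "-c" "\<lambda>_. 1"] c by (auto simp: avg_one)
    moreover have "avg N (\<lambda>y. of_bool (?C y)) = 1 / 2 ^ card (insert j ?K)"
      using fin K ij c e(1) by (intro avg_forced) (auto simp: e'_def)
    ultimately show ?thesis by (simp only: avg_add)
  qed
  finally show ?thesis using fin by simp
qed

text \<open>The two star triples have joint density 5/8, and the branch \<open>- c\<close> makes
  both trivial, so the branch \<open>c\<close> has density 1/4. In the branch \<open>- c\<close> the
  third vector stays nontrivial and gives at most 3/4; the mean is 1/2.\<close>

lemma dens_star_third:
  assumes ij: "i \<noteq> j" and c: "c = 1 \<or> c = -1"
    and b1: "oddvec N b1" "star i j c b1" and b2: "oddvec N b2" "star i j c b2"
    and ne: "supp b1 \<noteq> supp b2"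
    and b3: "oddvec N b3" "3 \<le> card (supp b3)" "\<not> star i j c b3"
  shows "dens N {b1, b2, b3} \<le> 1 / 2"
proof -
  have nz: "b1 j \<noteq> 0" "b1 i \<noteq> 0" "b2 j \<noteq> 0" "b2 i \<noteq> 0"
    using b1 b2 c by (auto simp: star_def)
  have lt: "i < N" "j < N" using oddvec_less[OF b1(1)] nz by auto
  have c': "- c = 1 \<or> - c = -1" using c by auto
  obtain k where k: "supp b1 = {i, j, k}" "k \<noteq> i" "k \<noteq> j" using star_supp[OF b1(2) ij c] by blast
  obtain l where l: "supp b2 = {i, j, l}" "l \<noteq> i" "l \<noteq> j" using star_supp[OF b2(2) ij c] by blast
  have kl: "k \<noteq> l" using ne k l by auto
  have z: "b1 m = 0 \<or> b2 m = 0" if "m \<notin> {i, j}" for m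
  proof -
    have "m \<notin> supp b1 \<or> m \<notin> supp b2" using that k l kl by auto
    then show ?thesis by (simp add: supp_def)
  qed
  have "\<Union> (supp ` {b1, b2}) - {i, j} = {k, l}" using k l by auto
  then have s: "dens N {b1, b2} = 5 / 8"
    using dens_star[OF ij lt c, of "{b1, b2}"] b1 b2 z kl by auto
  have triv: "dens N (insert (merge i j (- c) b) B) = dens N B"
    if b: "oddvec N b" "star i j c b" for b B
  proof -
    have "b j \<noteq> 0" "b i = - (- c) * b j" "card (supp b) = 3" using b by (auto simp: star_def)
    then show ?thesis
      using merge_cancel(1,2)[OF b(1) ij _ _ c'] by (intro dens_trivial) auto
  qed
  have "dens N (merge i j (- c) ` {b1, b2}) = 1"
    using triv[OF b1] triv[OF b2] by (simp add: dens_empty)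
  then have q: "dens N (merge i j c ` {b1, b2}) = 1 / 4"
    using dens_split[OF ij lt c, of "{b1, b2}"] s by simp
  have "dens N (merge i j c ` {b1, b2, b3}) \<le> 1 / 4"
    unfolding q[symmetric] by (rule dens_antimono) auto
  moreover have "dens N (merge i j (- c) ` {b1, b2, b3}) \<le> 3 / 4"
  proof (rule merge_cases[OF b3(1) ij lt(1) c'])
    assume "b3 i = 0 \<or> b3 j = 0"
    then show ?thesis using b3 ij lt c' by (intro dens_merge_swap3[of N b3]) auto
  next
    \<comment> \<open>A triple cancelling here would belong to the star, so \<open>b3\<close> has at
      least five entries and at least three survive.\<close>
    assume h: "b3 j \<noteq> 0" "b3 i = - (- c) * b3 j" "oddvec N (merge i j (- c) b3)"
      "card (supp b3) = card (supp (merge i j (- c) b3)) + 2"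
    then have "card (supp b3) \<noteq> 3" using b3(3) by (simp add: star_def)
    then have "5 \<le> card (supp b3)" using oddvec_card_3[OF b3(1,2)] by simp
    then show ?thesis using h by (intro dens_ge3[of N "merge i j (- c) b3"]) auto
  next
    assume "b3 j \<noteq> 0" "b3 i = - c * b3 j"
    then show ?thesis using dens_merge_double[OF b3(1) _ ij _ _ c', of "{b1, b2, b3}"] by simp
  qed
  ultimately show ?thesis using dens_split[OF ij lt c, of "{b1, b2, b3}"] by simp
qed

text \<open>Merging along the pair \<open>i, j\<close> makes the third vector trivial or equal, up to sign, to the
  second one; stated symmetrically in \<open>i\<close> and \<open>j\<close>.\<close>
definition bad_pair :: "(nat \<Rightarrow> real) \<Rightarrow> (nat \<Rightarrow> real) \<Rightarrow> (nat \<Rightarrow> real) \<Rightarrow> nat \<Rightarrow> nat \<Rightarrow> bool" where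
  "bad_pair b1 b2 b3 i j \<longleftrightarrow>
    (\<exists>m. m \<notin> {i, j} \<and> (\<forall>l. l \<notin> {i, j, m} \<longrightarrow> b3 l = 0) \<and> b1 i * b3 i = b1 j * b3 j) \<or>
    (\<exists>e. (e = 1 \<or> e = -1) \<and> (\<forall>l. l \<notin> {i, j} \<longrightarrow> b3 l = e * b2 l) \<and>
      b1 i * (b3 i - e * b2 i) = b1 j * (b3 j - e * b2 j))"

lemma bad_pair_swap:
  assumes "bad_pair b1 b2 b3 i j"
  shows "bad_pair b1 b2 b3 j i"
proof -
  consider (T) m where "m \<notin> {i, j}" "\<forall>l. l \<notin> {i, j, m} \<longrightarrow> b3 l = 0" "b1 i * b3 i = b1 j * b3 j"
    | (E) e where "e = 1 \<or> e = -1" "\<forall>l. l \<notin> {i, j} \<longrightarrow> b3 l = e * b2 l"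
      "b1 i * (b3 i - e * b2 i) = b1 j * (b3 j - e * b2 j)"
    using assms unfolding bad_pair_def by blast
  then show ?thesis
  proof cases
    case T
    then have "m \<notin> {j, i} \<and> (\<forall>l. l \<notin> {j, i, m} \<longrightarrow> b3 l = 0) \<and> b1 j * b3 j = b1 i * b3 i" by auto
    then show ?thesis unfolding bad_pair_def by blast
  next
    case E
    then have "(e = 1 \<or> e = -1) \<and> (\<forall>l. l \<notin> {j, i} \<longrightarrow> b3 l = e * b2 l) \<and>
      b1 j * (b3 j - e * b2 j) = b1 i * (b3 i - e * b2 i)" by auto
    then show ?thesis unfolding bad_pair_def by blast
  qed
qed

text \<open>Each bad pair is bad because \<open>b3\<close> becomes trivial or because it becomes
  \<open>b2\<close> up to sign. Two trivial merges make \<open>b3\<close> too short or equal to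
  \<open>b1\<close> up to sign; two merges of the other kind make it equal to \<open>b2\<close> up
  to sign. Mixed kinds clash at \<open>p\<close> and \<open>q\<close>: one demands two nonzero
  entries outside \<open>supp b1\<close>, the other allows only one.\<close>

lemma bad_pair_unique:
  assumes b1: "oddvec N b1" "supp b1 = {i, j, k}" "i \<noteq> j" "i \<noteq> k" "j \<noteq> k"
    and b2: "p \<noteq> q" "p \<notin> {i, j, k}" "q \<notin> {i, j, k}" "b2 p \<noteq> 0" "b2 q \<noteq> 0"
    and b3: "oddvec N b3" "3 \<le> card (supp b3)" "\<not> pm_eq b1 b3" "\<not> pm_eq b2 b3"
    and bad: "bad_pair b1 b2 b3 i j" "bad_pair b1 b2 b3 i k"
  shows False
proof -
  let ?T = "\<lambda>i j m. m \<notin> {i, j} \<and> (\<forall>l. l \<notin> {i, j, m} \<longrightarrow> b3 l = 0) \<and> b1 i * b3 i = b1 j * b3 j"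
  let ?E = "\<lambda>i j e. (e = 1 \<or> e = -1) \<and> (\<forall>l. l \<notin> {i, j} \<longrightarrow> b3 l = e * b2 l) \<and>
      b1 i * (b3 i - e * b2 i) = b1 j * (b3 j - e * b2 j)"
  have nz: "b1 i \<noteq> 0" "b1 j \<noteq> 0" "b1 k \<noteq> 0" using b1(2) by (auto simp: supp_def)
  have excl: False if "?T i u m" "?E i v e" "u \<in> {j, k}" "v \<in> {j, k}" for m e u v
  proof -
    have "b3 p = e * b2 p" "b3 q = e * b2 q" using that b2 by auto
    then have "b3 p \<noteq> 0" "b3 q \<noteq> 0" using that(2) b2 by auto
    moreover have "p \<notin> {i, u, m} \<or> q \<notin> {i, u, m}" using b2 that(3) by auto
    ultimately show False using that(1) by blast
  qed
  have one: "(\<exists>m. ?T i v m) \<or> (\<exists>e. ?E i v e)" if "bad_pair b1 b2 b3 i v" for v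
    using that by (simp only: bad_pair_def)
  consider (TT) m m' where "?T i j m" "?T i k m'" | (TE) m e where "?T i j m" "?E i k e"
    | (ET) m e where "?E i j e" "?T i k m" | (EE) e e' where "?E i j e" "?E i k e'"
    using one[OF bad(1)] one[OF bad(2)] by (elim disjE exE) (assumption | rule that; assumption)+
  then show False
  proof cases
    case TT
    show False
    \<comment> \<open>If \<open>m\<close> differs from \<open>k\<close>, the equations propagate the
      zero at \<open>k\<close> to \<open>i\<close> and \<open>j\<close>, and only \<open>m\<close>
      can remain. If \<open>m = k\<close>, the products of entries of \<open>b1\<close> and
      \<open>b3\<close> agree on all three positions, so the vectors are proportional.\<close>
    proof (cases "m = k")
      case False
      then have "b3 k = 0" using TT(1) b1 by auto
      then have "b3 i = 0" "b3 j = 0" using TT nz by auto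
      then have "supp b3 \<subseteq> {m}" using TT(1) by (auto simp: supp_def)
      then have "card (supp b3) \<le> 1" using card_mono[of "{m}" "supp b3"] by simp
      then show False using b3(2) by simp
    next
      case True
      define v where "v = b1 i * b3 i"
      have eq: "b3 l = v * b1 l" for l
      proof (cases "l \<in> {i, j, k}")
        case True
        then have "b1 l * b3 l = v" "b1 l \<noteq> 0" using TT nz by (auto simp: v_def)
        then show ?thesis using oddvec_pm[OF b1(1), of l] by auto
      next
        case False
        then have "b3 l = 0" "l \<notin> supp b1" using TT(1) True b1(2) by auto
        then show ?thesis by (simp add: supp_def)
      qed
      have "v \<noteq> 0"
      proof
        assume "v = 0"
        then have "supp b3 = {}" using eq by (auto simp: supp_def)
        then show False using b3(2) by simp
      qed
      then have "b3 i \<noteq> 0" by (auto simp: v_def)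
      then have "v = 1 \<or> v = -1"
        using oddvec_pm[OF b1(1) nz(1)] oddvec_pm[OF b3(1), of i] by (auto simp: v_def)
      then show False using pm_eqI[of b3 v b1] eq b3(3) by blast
    qed
  next
    case TE then show False using excl[where u = j and m = m and v = k and e = e] by blast
  next
    case ET then show False using excl[where u = k and m = m and v = j and e = e] by blast
  next
    case EE
    \<comment> \<open>Position \<open>p\<close> lies outside both pairs, so it identifies the two
      signs. Each pair then settles the position missing from the other, and the remaining equation
      settles \<open>i\<close>.\<close>
    have "b3 p = e * b2 p" "b3 p = e' * b2 p" using EE b2 by auto
    then have ee: "e' = e" using b2 by simp
    have k: "b3 k = e * b2 k" using EE(1) b1 by auto
    have j: "b3 j = e * b2 j" using EE(2) b1 ee by auto
    have "b1 i * (b3 i - e * b2 i) = 0" using EE(2) k ee by simp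
    then have "b3 i = e * b2 i" using nz by simp
    then have "b3 l = e * b2 l" for l using j EE(1) by (cases "l \<in> {i, j}") auto
    then show False using pm_eqI[of b3 e b2] EE(1) b3(4) by blast
  qed
qed

text \<open>The merge that cancels \<open>b1\<close> at \<open>i\<close> and \<open>j\<close> leaves
  \<open>b i - b1 i * b1 j * b j\<close> at \<open>i\<close>. Multiplication by \<open>b1 i\<close>
  turns its vanishing into the symmetric equation used in \<open>bad_pair\<close>.\<close>

lemma bad_pairI:
  assumes b1: "oddvec N b1" "b1 i \<noteq> 0" "b1 j \<noteq> 0" "i \<noteq> j"
    and b3: "oddvec N b3" "3 \<le> card (supp b3)"
    and bad: "card (supp (merge i j (- (b1 i * b1 j)) b3)) = 1 \<or>
      pm_eq (merge i j (- (b1 i * b1 j)) b2) (merge i j (- (b1 i * b1 j)) b3)"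
  shows "bad_pair b1 b2 b3 i j"
  using bad
proof
  let ?M = "merge i j (- (b1 i * b1 j))"
  note pm = oddvec_pm[OF b1(1,2)] oddvec_pm[OF b1(1,3)]
  have Ml: "?M b l = b l" if "l \<notin> {i, j}" for b l using that by (auto simp: merge_def)
  have Mi: "?M b i = b i - b1 i * b1 j * b j" for b using b1(4) by (simp add: merge_def)
  assume "card (supp (?M b3)) = 1"
  then obtain m where m: "supp (?M b3) = {m}" by (auto simp: card_1_singleton_iff)
  then have zero: "?M b3 l = 0" if "l \<noteq> m" for l
    using that by (auto simp: supp_def)
  have mj: "m \<noteq> j" using m by (auto simp: supp_def merge_def)
  \<comment> \<open>If the surviving entry were at \<open>i\<close>, all of \<open>b3\<close> would
    lie on the two merged positions, which is too few.\<close>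
  have mi: "m \<noteq> i"
  proof
    assume "m = i"
    then have "supp b3 \<subseteq> {i, j}" using zero Ml[of _ b3] by (force simp: supp_def)
    then have "card (supp b3) \<le> card {i, j}" by (intro card_mono) auto
    then show False using b3(2) b1(4) by simp
  qed
  have "b3 l = 0" if "l \<notin> {i, j, m}" for l using that zero[of l] Ml[of l b3] by auto
  moreover have "b1 i * b3 i = b1 j * b3 j" using zero[of i] mi Mi[of b3] pm by auto
  ultimately show ?thesis using mi mj unfolding bad_pair_def by blast
next
  let ?M = "merge i j (- (b1 i * b1 j))"
  note pm = oddvec_pm[OF b1(1,2)] oddvec_pm[OF b1(1,3)]
  have Ml: "?M b l = b l" if "l \<notin> {i, j}" for b l using that by (auto simp: merge_def)
  have Mi: "?M b i = b i - b1 i * b1 j * b j" for b using b1(4) by (simp add: merge_def)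
  assume "pm_eq (?M b2) (?M b3)"
  then obtain e where e: "e = 1 \<or> e = -1" "\<And>l. ?M b3 l = e * ?M b2 l"
    unfolding pm_eq_def by (metis mult_1 mult_minus1)
  have "b3 l = e * b2 l" if "l \<notin> {i, j}" for l using e(2)[of l] Ml[OF that] by simp
  moreover have "b1 i * (b3 i - e * b2 i) = b1 j * (b3 j - e * b2 j)"
    using e(2)[of i] pm unfolding Mi by (auto simp: algebra_simps)
  ultimately show ?thesis using e(1) unfolding bad_pair_def by blast
qed

text \<open>In the decomposition along \<open>b1\<close>, the small overlap keeps \<open>b2\<close>
  a triple in all three merges. Each summand is at most 3/4, and at most 5/8 unless its pair is bad.
  At most one pair is bad, so the sum is at most 3/4 + 5/8 + 5/8 = 2.\<close>

lemma dens_third: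
  assumes b1: "oddvec N b1" "card (supp b1) = 3" and b2: "oddvec N b2" "card (supp b2) = 3"
    and ov: "card (supp b1 \<inter> supp b2) \<le> 1"
    and b3: "oddvec N b3" "3 \<le> card (supp b3)" "\<not> pm_eq b1 b3" "\<not> pm_eq b2 b3"
  shows "dens N {b1, b2, b3} \<le> 1 / 2"
proof -
  let ?D = "\<lambda>i j. dens N (merge i j (- (b1 i * b1 j)) ` {b1, b2, b3})"
  have fin: "finite (supp b1)" "finite (supp b2)" using b1 b2 oddvec_finite by auto
  obtain i j k where ijk: "supp b1 = {i, j, k}" "i \<noteq> j" "i \<noteq> k" "j \<noteq> k"
    using b1(2) by (auto simp: card_3_iff)
  have nz: "b1 i \<noteq> 0" "b1 j \<noteq> 0" "b1 k \<noteq> 0" using ijk(1) by (auto simp: supp_def)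
  have "2 \<le> card (supp b2 - supp b1)"
    using card_Int_Diff[OF fin(2), of "supp b1"] ov b2(2) by (simp add: Int_commute)
  then obtain S where "S \<subseteq> supp b2 - supp b1" "card S = 2"
    by (meson obtain_subset_with_card_n)
  then obtain p q where "p \<noteq> q" "p \<in> supp b2 - supp b1" "q \<in> supp b2 - supp b1"
    by (auto simp: card_2_iff)
  then have pq: "p \<noteq> q" "p \<notin> supp b1" "q \<notin> supp b1" "b2 p \<noteq> 0" "b2 q \<noteq> 0"
    by (auto simp: supp_def)
  have D: "?D u v \<le> 3 / 4" "\<not> bad_pair b1 b2 b3 u v \<Longrightarrow> ?D u v \<le> 5 / 8"
    if uv: "b1 u \<noteq> 0" "b1 v \<noteq> 0" "u \<noteq> v" for u v
  proof -
    let ?c = "- (b1 u * b1 v)"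
    have c: "?c = 1 \<or> ?c = -1" using oddvec_prod(1)[OF b1(1) uv(1,2)] by auto
    have lt: "u < N" using oddvec_less[OF b1(1) uv(1)] .
    have z: "b2 u = 0 \<or> b2 v = 0"
    proof (rule ccontr)
      assume "\<not> ?thesis"
      then have "{u, v} \<subseteq> supp b1 \<inter> supp b2" using uv by (auto simp: supp_def)
      then have "card {u, v} \<le> card (supp b1 \<inter> supp b2)" using fin by (intro card_mono) auto
      then show False using ov uv(3) by simp
    qed
    have m2: "oddvec N (merge u v ?c b2)" "card (supp (merge u v ?c b2)) = 3"
      using merge_swap[OF b2(1) uv(3) lt c z] b2(2) by auto
    show "?D u v \<le> 3 / 4"
      using b2 uv lt c z by (intro dens_merge_swap3[of N b2]) auto
    assume "\<not> bad_pair b1 b2 b3 u v"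
    then have nb: "card (supp (merge u v ?c b3)) \<noteq> 1"
      "\<not> pm_eq (merge u v ?c b2) (merge u v ?c b3)"
      using bad_pairI[OF b1(1) uv b3(1,2)] by auto
    have pair: "?D u v \<le> 5 / 8"
      if m3: "oddvec N (merge u v ?c b3)" "3 \<le> card (supp (merge u v ?c b3))"
    proof -
      have "?D u v \<le> dens N {merge u v ?c b2, merge u v ?c b3}" by (rule dens_antimono) auto
      also have "\<dots> \<le> 5 / 8" using m2 m3 nb by (intro dens_pair_le) auto
      finally show ?thesis .
    qed
    show "?D u v \<le> 5 / 8"
    proof (rule merge_cases[OF b3(1) uv(3) lt c])
      assume "oddvec N (merge u v ?c b3)" "card (supp (merge u v ?c b3)) = card (supp b3)"
      then show ?thesis using pair b3(2) by simp
    next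
      assume m: "oddvec N (merge u v ?c b3)" "card (supp b3) = card (supp (merge u v ?c b3)) + 2"
      have "3 \<le> card (supp (merge u v ?c b3))"
        using m nb(1) b3(2) oddvec_card_3[OF b3(1,2)] by auto
      then show ?thesis using pair m(1) by simp
    next
      assume "b3 v \<noteq> 0" "b3 u = ?c * b3 v"
      then show ?thesis
        using dens_merge_double[OF b3(1) _ uv(3) _ _ c, of "{b1, b2, b3}"] by simp
    qed
  qed
  \<comment> \<open>Any two of the three pairs share a vertex, so uniqueness is applied at
    \<open>i\<close>, \<open>j\<close> and \<open>k\<close> in turn, using the symmetry of
    \<open>bad_pair\<close>.\<close>
  have u1: "\<not> (bad_pair b1 b2 b3 i j \<and> bad_pair b1 b2 b3 i k)"
    using bad_pair_unique[OF b1(1) ijk pq(1) _ _ pq(4,5) b3] pq(2,3) ijk(1) by auto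
  have u2: "\<not> (bad_pair b1 b2 b3 i j \<and> bad_pair b1 b2 b3 j k)"
    using bad_pair_unique[OF b1(1) _ _ _ _ pq(1) _ _ pq(4,5) b3, of j i k] pq(2,3) ijk
      bad_pair_swap[of b1 b2 b3 i j] by auto
  have u3: "\<not> (bad_pair b1 b2 b3 i k \<and> bad_pair b1 b2 b3 j k)"
    using bad_pair_unique[OF b1(1) _ _ _ _ pq(1) _ _ pq(4,5) b3, of k i j] pq(2,3) ijk
      bad_pair_swap[of b1 b2 b3 i k] bad_pair_swap[of b1 b2 b3 j k] by auto
  have "?D i j + ?D i k + ?D j k \<le> 2"
    using D[OF nz(1,2) ijk(2)] D[OF nz(1,3) ijk(3)] D[OF nz(2,3) ijk(4)] u1 u2 u3 by argo
  then show ?thesis using dens_three[OF b1(1) _ ijk, of "{b1, b2, b3}"] by simp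
qed

section \<open>Classification of the large densities\<close>

text \<open>Two common positions must carry the same relative sign in both triples, which makes them
  members of one star; equal supports would make the vectors equal up to sign.\<close>

lemma overlap_cases:
  assumes b: "oddvec N b" "card (supp b) = 3" and b': "oddvec N b'" "card (supp b') = 3"
    and ne: "\<not> pm_eq b b'" and gt: "1 / 2 < dens N {b, b'}"
  obtains (small) "card (supp b \<inter> supp b') \<le> 1"
  | (star) i j c where "i \<noteq> j" "c = 1 \<or> c = -1" "star i j c b" "star i j c b'" "supp b \<noteq> supp b'"
proof (cases "card (supp b \<inter> supp b') \<le> 1")
  case True
  then show ?thesis using small by blast
next
  case False
  then have "2 \<le> card (supp b \<inter> supp b')" by simp
  then obtain S where "S \<subseteq> supp b \<inter> supp b'" "card S = 2"
    by (meson obtain_subset_with_card_n)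
  then obtain i j where "i \<noteq> j" "i \<in> supp b \<inter> supp b'" "j \<in> supp b \<inter> supp b'"
    by (auto simp: card_2_iff)
  then have ij: "i \<noteq> j" "b i \<noteq> 0" "b j \<noteq> 0" "b' i \<noteq> 0" "b' j \<noteq> 0" by (auto simp: supp_def)
  obtain e where e: "e = 1 \<or> e = -1" "\<And>i. b i \<noteq> 0 \<Longrightarrow> b' i \<noteq> 0 \<Longrightarrow> b' i = e * b i"
    using consistent_overlap[OF b(1) b'(1) _ _ gt] by auto
  note p = oddvec_prod[OF b(1) ij(2,3)]
  have "b' i = b i * b j * b' j" using e(2)[OF ij(2,4)] e(2)[OF ij(3,5)] p(2) by simp
  then have "star i j (b i * b j) b" "star i j (b i * b j) b'"
    using ij p(2) b b' by (auto simp: star_def)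
  moreover have "supp b \<noteq> supp b'"
  proof
    assume "supp b = supp b'"
    then have "b' l = e * b l" for l
      using e(2)[of l] by (cases "b l = 0"; cases "b' l = 0") (auto simp: supp_def)
    then show False using ne e(1) pm_eqI[of b' e b] by blast
  qed
  ultimately show ?thesis using star ij(1) p(1) by blast
qed

text \<open>Any pair of positions of \<open>b\<close> misses \<open>b'\<close> at least once, so
  every merge along it only moves an entry of \<open>b'\<close>.\<close>

lemma dens_small_overlap:
  assumes b: "oddvec N b" "card (supp b) = 3" and b': "oddvec N b'" "card (supp b') = 3"
    and ov: "card (supp b \<inter> supp b') \<le> 1"
  shows "dens N {b, b'} = 9 / 16"
proof -
  obtain i j k where ijk: "supp b = {i, j, k}" "i \<noteq> j" "i \<noteq> k" "j \<noteq> k"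
    using b(2) by (auto simp: card_3_iff)
  show ?thesis
  proof (rule dens_pair_eq_9_16[OF b(1) ijk])
    fix u v assume uv: "b u \<noteq> 0" "b v \<noteq> 0" "u \<noteq> v"
    have "b' u = 0 \<or> b' v = 0"
    proof (rule ccontr)
      assume "\<not> ?thesis"
      then have "{u, v} \<subseteq> supp b \<inter> supp b'" using uv by (auto simp: supp_def)
      then have "card {u, v} \<le> card (supp b \<inter> supp b')"
        using oddvec_finite[OF b(1)] by (intro card_mono) auto
      then show False using ov uv(3) by simp
    qed
    then show "oddvec N (merge u v (- (b u * b v)) b') \<and> card (supp (merge u v (- (b u * b v)) b')) = 3"
      using merge_swap[OF b'(1) uv(3) oddvec_less[OF b(1) uv(1)], of "- (b u * b v)"]
        oddvec_prod(1)[OF b(1) uv(1,2)] b'(2) by auto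
  qed
qed

text \<open>The signs agree on the triple up to a common factor, so the merge that cancels a pair in
  \<open>b\<close> also cancels it in \<open>b'\<close> and leaves three entries.\<close>

lemma dens_3_in_5:
  assumes b: "oddvec N b" "card (supp b) = 3" and b': "oddvec N b'" "card (supp b') = 5"
    and sub: "supp b \<subseteq> supp b'" and gt: "1 / 2 < dens N {b, b'}"
  shows "dens N {b, b'} = 9 / 16"
proof -
  obtain i j k where ijk: "supp b = {i, j, k}" "i \<noteq> j" "i \<noteq> k" "j \<noteq> k"
    using b(2) by (auto simp: card_3_iff)
  obtain e where e: "e = 1 \<or> e = -1" "\<And>i. b i \<noteq> 0 \<Longrightarrow> b' i \<noteq> 0 \<Longrightarrow> b' i = e * b i"
    using consistent_overlap[OF b(1) b'(1) _ _ gt] by auto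
  show ?thesis
  proof (rule dens_pair_eq_9_16[OF b(1) ijk])
    fix u v assume uv: "b u \<noteq> 0" "b v \<noteq> 0" "u \<noteq> v"
    have nz: "b' u \<noteq> 0" "b' v \<noteq> 0" using uv sub by (auto simp: supp_def)
    have c: "- (b u * b v) = 1 \<or> - (b u * b v) = -1" "b u = b u * b v * b v"
      using oddvec_prod[OF b(1) uv(1,2)] by auto
    have "b' u = - (- (b u * b v)) * b' v"
      using e(2)[OF uv(1) nz(1)] e(2)[OF uv(2) nz(2)] c(2) by simp
    then show "oddvec N (merge u v (- (b u * b v)) b') \<and> card (supp (merge u v (- (b u * b v)) b')) = 3"
      using merge_cancel(1,2)[OF b'(1) uv(3) nz(2) _ c(1)] b'(2) by auto
  qed
qed

lemma abs_dot_pm_eq: "pm_eq b x \<Longrightarrow> \<bar>dot N x y\<bar> = \<bar>dot N b y\<bar>"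
  by (auto simp: pm_eq_def dot_neg)

lemma dens_reduce2:
  assumes "b \<in> F" "b' \<in> F" "\<And>x. x \<in> F \<Longrightarrow> pm_eq b x \<or> pm_eq b' x"
  shows "dens N F = dens N {b, b'}"
proof (rule dens_cong)
  fix y
  have "\<bar>dot N x y\<bar> = 1" if "x \<in> F" "\<bar>dot N b y\<bar> = 1" "\<bar>dot N b' y\<bar> = 1" for x
    using assms(3)[OF that(1)] that(2,3) abs_dot_pm_eq by metis
  then show "ok N F y = ok N {b, b'} y" using assms(1,2) by (auto simp: ok_def)
qed

lemma dens_reduce1: "b \<in> F \<Longrightarrow> (\<And>x. x \<in> F \<Longrightarrow> pm_eq b x) \<Longrightarrow> dens N F = dens N {b}"
  using dens_reduce2[of b F b N] by simp

text \<open>For \<open>N = k + 1\<close>, multiplication by 2^k gives the sizes 2^(k-1) + 2^(k-s)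
  with s from 1 to k. The exceptional value 35/64 = 1/2 + 1/32 + 1/64 comes from a single vector of
  support seven.\<close>

definition large_density :: "nat \<Rightarrow> real \<Rightarrow> bool" where
  "large_density N d \<longleftrightarrow> d = 35 / 64 \<or> (\<exists>s. 1 \<le> s \<and> s < N \<and> d = 1 / 2 + 1 / 2 ^ s)"

lemma large_densityI: "1 \<le> s \<Longrightarrow> s < N \<Longrightarrow> d = 1 / 2 + 1 / 2 ^ s \<Longrightarrow> large_density N d"
  by (auto simp: large_density_def)

text \<open>The bounds for three vectors leave few shapes up to sign: no vector, one vector of
  support 3, 5 or 7, a triple inside a quintuple, two triples with small overlap, or a star.\<close>

lemma dens_classification:
  assumes N: "7 \<le> N" and F: "\<And>b. b \<in> F \<Longrightarrow> oddvec N b" "\<And>b. b \<in> F \<Longrightarrow> 3 \<le> card (supp b)"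
    and gt: "1 / 2 < dens N F"
  shows "large_density N (dens N F)"
proof (cases "F = {}")
  case True
  then show ?thesis using N by (intro large_densityI[of 1]) (auto simp: dens_empty)
next
  case nonempty: False
  have sub: "1 / 2 < dens N B" if "B \<subseteq> F" for B
    using dens_antimono[OF that, of N] gt by simp
  have third: False
    if h: "b1 \<in> F" "b2 \<in> F" "b3 \<in> F" "card (supp b1) = 3" "card (supp b2) = 3"
      "\<not> pm_eq b1 b3" "\<not> pm_eq b2 b3" "card (supp b1 \<inter> supp b2) \<le> 1" for b1 b2 b3
    using dens_third[OF F(1)[OF h(1)] h(4) F(1)[OF h(2)] h(5,8) F(1,2)[OF h(3)] h(6,7)]
      sub[of "{b1, b2, b3}"] h(1-3) by simp
  have star_third: "star i j c b3"
    if h: "b1 \<in> F" "b2 \<in> F" "b3 \<in> F" "i \<noteq> j" "c = 1 \<or> c = -1" "star i j c b1" "star i j c b2"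
      "supp b1 \<noteq> supp b2" for b1 b2 b3 i j c
    using dens_star_third[OF h(4,5) F(1)[OF h(1)] h(6) F(1)[OF h(2)] h(7,8) F(1,2)[OF h(3)]]
      sub[of "{b1, b2, b3}"] h(1-3) by auto
  show ?thesis
  proof (cases "\<exists>b\<in>F. 5 \<le> card (supp b)")
    case True
    then obtain b where b: "b \<in> F" "5 \<le> card (supp b)" by blast
    show ?thesis
    proof (cases "\<exists>b'\<in>F. \<not> pm_eq b b'")
      case False
      then have d: "dens N F = dens N {b}" using dens_reduce1[OF b(1)] by blast
      obtain t where t: "card (supp b) = 2 * t + 1" using F(1)[OF b(1)] by (auto simp: oddvec_def elim!: oddE)
      have dt: "dens N F = delta t" using d dens_single[OF F(1)[OF b(1)] t] by simp
      \<comment> \<open>From support nine on the density is at most 63/128, which is below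
        1/2.\<close>
      then have "\<not> 4 \<le> t" using gt delta_mono[of 4 t] delta_values(4) by (auto simp del: delta.simps)
      then consider "t = 2" | "t = 3" using t b(2) by linarith
      then show ?thesis
      proof cases
        case 1
        then show ?thesis using dt delta_values(2) N by (intro large_densityI[of 3]) (auto simp del: delta.simps)
      next
        case 2
        then show ?thesis using dt delta_values(3) by (simp add: large_density_def del: delta.simps)
      qed
    next
      case True
      then obtain b' where b': "b' \<in> F" "\<not> pm_eq b b'" by blast
      have sub5: "card (supp x) = 3 \<and> supp x \<subseteq> supp b \<and> card (supp b) = 5"
        if x: "x \<in> F" "\<not> pm_eq b x" for x
      proof -
        have g: "1 / 2 < dens N {b, x}" using sub[of "{b, x}"] b x by simp
        have "\<not> 5 \<le> card (supp x)"
          using dens_pair_ge5[OF F(1)[OF b(1)] b(2) F(1)[OF x(1)] _ x(2)] g by auto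
        then have x3: "card (supp x) = 3" using oddvec_card_3[OF F[OF x(1)]] by simp
        moreover have "supp x \<subseteq> supp b \<and> card (supp b) = 5"
          using dens_3_ge5_half[OF F(1)[OF x(1)] x3 F(1)[OF b(1)] b(2)] g
          by (auto simp: insert_commute)
        ultimately show ?thesis by blast
      qed
      note s' = sub5[OF b']
      show ?thesis
      proof (cases "\<exists>x\<in>F. \<not> pm_eq b x \<and> \<not> pm_eq b' x")
        case False
        then have "dens N F = dens N {b, b'}" using dens_reduce2[OF b(1) b'(1)] by blast
        moreover have "dens N {b', b} = 9 / 16"
          using dens_3_in_5[OF F(1)[OF b'(1)] _ F(1)[OF b(1)]] s' sub[of "{b', b}"] b b' by simp
        ultimately show ?thesis using N by (intro large_densityI[of 4]) (auto simp: insert_commute)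
      next
        case True
        then obtain x where x: "x \<in> F" "\<not> pm_eq b x" "\<not> pm_eq b' x" by blast
        note sx = sub5[OF x(1,2)]
        have "1 / 2 < dens N {b', x}" using sub[of "{b', x}"] b' x by simp
        \<comment> \<open>Two different triples beside \<open>b\<close> either overlap little, which
          leaves no room for \<open>b\<close> as a third vector, or form a star, which would force
          \<open>b\<close> to be a triple.\<close>
        then have False
        proof (rule overlap_cases[OF F(1)[OF b'(1)] _ F(1)[OF x(1)] _ x(3), rotated 2])
          assume "card (supp b' \<inter> supp x) \<le> 1"
          then show False
            using third[OF b'(1) x(1) b(1)] s' sx b'(2) x(2) pm_eq_sym by blast
        next
          fix i j c assume "i \<noteq> j" "c = 1 \<or> c = (-1::real)" "star i j c b'" "star i j c x" "supp b' \<noteq> supp x"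
          then have "star i j c b" using star_third[OF b'(1) x(1) b(1)] by blast
          then show False using b(2) by (simp add: star_def)
        qed (use s' sx in auto)
        then show ?thesis ..
      qed
    qed
  next
    case False
    then have c3: "card (supp b) = 3" if "b \<in> F" for b
      using oddvec_card_3[OF F[OF that]] that by blast
    obtain b where b: "b \<in> F" using nonempty by blast
    show ?thesis
    proof (cases "\<exists>b'\<in>F. \<not> pm_eq b b'")
      case False
      then have "dens N F = dens N {b}" using dens_reduce1[OF b] by blast
      then show ?thesis
        using dens_eq3[OF F(1)[OF b] c3[OF b]] N by (intro large_densityI[of 2]) auto
    next
      case True
      then obtain b' where b': "b' \<in> F" "\<not> pm_eq b b'" by blast
      have "1 / 2 < dens N {b, b'}" using sub[of "{b, b'}"] b b' by simp
      then show ?thesis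
      proof (rule overlap_cases[OF F(1)[OF b] c3[OF b] F(1)[OF b'(1)] c3[OF b'(1)] b'(2)])
        assume ov: "card (supp b \<inter> supp b') \<le> 1"
        have "pm_eq b x \<or> pm_eq b' x" if "x \<in> F" for x
          using third[OF b b'(1) that c3[OF b] c3[OF b'(1)] _ _ ov] by blast
        then have "dens N F = dens N {b, b'}" using dens_reduce2[OF b b'(1)] by blast
        then show ?thesis
          using dens_small_overlap[OF F(1)[OF b] c3[OF b] F(1)[OF b'(1)] c3[OF b'(1)] ov] N
          by (intro large_densityI[of 4]) auto
      next
        fix i j c
        assume s: "i \<noteq> j" "c = 1 \<or> c = (-1::real)" "star i j c b" "star i j c b'" "supp b \<noteq> supp b'"
        have all: "star i j c x" if "x \<in> F" for x
          using star_third[OF b b'(1) that s] .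
        have nz: "x i \<noteq> 0" "x j \<noteq> 0" if "x \<in> F" for x
          using all[OF that] s(2) by (auto simp: star_def)
        have lt: "i < N" "j < N" using nz[OF b] oddvec_less[OF F(1)[OF b]] by auto
        have cons: "u i * u k = v i * v k"
          if "u \<in> F" "v \<in> F" "k \<notin> {i, j}" "u k \<noteq> 0" "v k \<noteq> 0" for u v k
        proof (rule ccontr)
          assume "u i * u k \<noteq> v i * v k"
          then have "dens N F \<le> 1 / 2"
            using that nz F(1) by (intro dens_mixed[of N u v F i k]) auto
          then show False using gt by simp
        qed
        let ?K = "\<Union> (supp ` F) - {i, j}"
        \<comment> \<open>The tips avoid the two centre positions, so there are at most
          \<open>N - 2\<close> of them and the exponent stays below \<open>N\<close>.\<close>
        have "?K \<subseteq> {..<N} - {i, j}" using F(1) by (auto simp: oddvec_def)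
        then have "card ?K \<le> card ({..<N} - {i, j})" by (intro card_mono) auto
        also have "\<dots> = N - 2" using s(1) lt by (subst card_Diff_subset) auto
        finally have "card ?K + 1 < N" using N by simp
        moreover have "dens N F = 1 / 2 + 1 / 2 ^ (card ?K + 1)"
          using dens_star[OF s(1) lt s(2) F(1) all cons] by blast
        ultimately show ?thesis by (intro large_densityI[of "card ?K + 1"]) auto
      qed
    qed
  qed
qed

section \<open>Intersection sizes\<close>

text \<open>With \<open>y k = 1\<close> and \<open>x i = (1 - y i) / 2\<close>, the condition \<open>a \<cdot> x \<in> {0, 1}\<close> becomes
  \<open>\<bar>2 (a \<cdot> x) - 1\<bar> = 1\<close>, which is homogeneous in \<open>y\<close>.\<close>
definition row :: "nat \<Rightarrow> (nat \<Rightarrow> real) \<Rightarrow> nat \<Rightarrow> real" where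
  "row k a = (\<lambda>i. if i < k then - a i else if i = k then (\<Sum>l<k. a l) - 1 else 0)"

lemma dot_row:
  assumes "y k = 1"
  shows "dot (Suc k) (row k a) y = 2 * (\<Sum>i<k. a i * ((1 - y i) / 2)) - 1"
proof -
  have "dot (Suc k) (row k a) y = (\<Sum>i<k. - a i * y i) + ((\<Sum>l<k. a l) - 1)"
    using assms by (simp add: dot_def row_def)
  also have "\<dots> = (\<Sum>i<k. a i * (1 - y i)) - 1"
    by (simp add: algebra_simps sum_subtractf sum_negf)
  also have "(\<Sum>i<k. a i * (1 - y i)) = 2 * (\<Sum>i<k. a i * ((1 - y i) / 2))"
    by (simp add: sum_distrib_left)
  finally show ?thesis .
qed

lemma dot_row_ok:
  "y k = 1 \<Longrightarrow> \<bar>dot (Suc k) (row k a) y\<bar> = 1 \<longleftrightarrow> (\<Sum>i<k. a i * ((1 - y i) / 2)) \<in> {0, 1}"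
  unfolding dot_row by auto

lemma sum_row: "(\<Sum>i<Suc k. row k a i) = -1"
  by (simp add: row_def sum_negf)

text \<open>Cube points correspond to the valid sign vectors with last sign 1. The conditions are
  invariant under negating \<open>y\<close>, so these are half of all valid vectors, which turns the
  factor 2^(k+1) into 2^k.\<close>

lemma card_cube_dens:
  defines "X R k \<equiv> {x \<in> cube k. \<forall>a\<in>R. (\<Sum>i<k. a i * x i) \<in> {0, 1}}"
  shows "finite (X R k)" "real (card (X R k)) = 2 ^ k * dens (Suc k) (row k ` R)"
proof -
  let ?N = "Suc k"
  define Y where "Y = {y \<in> signs ?N. ok ?N (row k ` R) y}"
  define Y1 where "Y1 = {y \<in> Y. y k = 1}"
  define Y2 where "Y2 = {y \<in> Y. y k = -1}"
  have finY: "finite Y" by (simp add: Y_def)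
  let ?g = "\<lambda>(y :: nat \<Rightarrow> real) i. if i < k then (1 - y i) / 2 else 0"
  let ?h = "\<lambda>(x :: nat \<Rightarrow> real) i. if i < k then 1 - 2 * x i else if i = k then 1 else 0"
  have sum_g: "(\<Sum>i<k. a i * ?g y i) = (\<Sum>i<k. a i * ((1 - y i) / 2))" for a y
    by (intro sum.cong) auto
  have bij: "bij_betw ?g Y1 (X R k)"
  proof (rule bij_betw_byWitness[where f' = ?h])
    show "\<forall>y\<in>Y1. ?h (?g y) = y"
      by (auto simp: Y1_def Y_def signs_def fun_eq_iff diff_divide_distrib)
    show "\<forall>x\<in>X R k. ?g (?h x) = x"
      by (auto simp: X_def cube_def fun_eq_iff)
    show "?g ` Y1 \<subseteq> X R k"
    proof
      fix x assume "x \<in> ?g ` Y1"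
      then obtain y where y: "y \<in> signs ?N" "ok ?N (row k ` R) y" "y k = 1" "x = ?g y"
        by (auto simp: Y1_def Y_def)
      have "x \<in> cube k" using signs_pm[OF y(1)] unfolding y(4) cube_def
        by (auto simp: less_Suc_eq)
      moreover have "(\<Sum>i<k. a i * x i) \<in> {0, 1}" if "a \<in> R" for a
      proof -
        have "\<bar>dot ?N (row k a) y\<bar> = 1" using y(2) that by (simp add: ok_def)
        then show ?thesis unfolding y(4) sum_g dot_row_ok[of y k a, OF y(3)] .
      qed
      ultimately show "x \<in> X R k" by (simp add: X_def)
    qed
    show "?h ` X R k \<subseteq> Y1"
    proof
      fix y assume "y \<in> ?h ` X R k"
      then obtain x where x: "x \<in> cube k" "\<And>a. a \<in> R \<Longrightarrow> (\<Sum>i<k. a i * x i) \<in> {0, 1}" "y = ?h x"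
        by (auto simp: X_def)
      have yk: "y k = 1" using x(3) by simp
      have "?h x i = 1 \<or> ?h x i = -1" if "i < ?N" for i
      proof (cases "i < k")
        case True
        then have "x i = 0 \<or> x i = 1" using x(1) by (auto simp: cube_def)
        then show ?thesis using True by auto
      next
        case False
        then show ?thesis using that by simp
      qed
      then have "y \<in> signs ?N" unfolding signs_def x(3) by simp
      moreover have "\<bar>dot ?N (row k a) y\<bar> = 1" if "a \<in> R" for a
      proof -
        have "(\<Sum>i<k. a i * ((1 - y i) / 2)) = (\<Sum>i<k. a i * x i)"
          unfolding x(3) by (intro sum.cong) auto
        then show ?thesis using x(2)[OF that] unfolding dot_row_ok[of y k a, OF yk] by simp
      qed
      ultimately show "y \<in> Y1" using yk by (simp add: Y1_def Y_def ok_def)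
    qed
  qed
  have finX: "finite (X R k)"
    using finY bij_betw_finite[OF bij] by (simp add: Y1_def)
  have cardX: "card (X R k) = card Y1"
    using bij_betw_same_card[OF bij] by simp
  have neg: "(\<lambda>i. - y i) \<in> Y" if "y \<in> Y" for y
  proof -
    have "(\<lambda>i. - y i) \<in> signs ?N"
      using that signs_pm[of y ?N] by (auto simp: Y_def signs_def)
    moreover have "dot ?N b (\<lambda>i. - y i) = - dot ?N b y" for b
      by (simp add: dot_def sum_negf)
    ultimately show ?thesis using that by (simp add: Y_def ok_def)
  qed
  have "bij_betw (\<lambda>y i. - y i) Y1 Y2"
    by (rule bij_betw_byWitness[where f' = "\<lambda>y i. - y i"]) (auto simp: Y1_def Y2_def neg)
  then have "card Y1 = card Y2" by (rule bij_betw_same_card)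
  moreover have "Y = Y1 \<union> Y2" using signs_pm[of _ ?N k] by (auto simp: Y1_def Y2_def Y_def)
  moreover have "card (Y1 \<union> Y2) = card Y1 + card Y2"
    using finY by (intro card_Un_disjoint) (auto simp: Y1_def Y2_def)
  ultimately have "card Y = 2 * card Y1" by presburger
  moreover have "dens ?N (row k ` R) = real (card Y) / 2 ^ ?N"
    by (simp add: dens_def avg_def Y_def sum.If_cases of_bool_def Int_def)
  ultimately show "real (card (X R k)) = 2 ^ k * dens ?N (row k ` R)" using cardX by simp
  show "finite (X R k)" by (rule finX)
qed

lemma sum_signs_parity:
  assumes "finite T" "\<And>i. i \<in> T \<Longrightarrow> b i = 1 \<or> b i = (-1 :: real)"
  shows "\<exists>z::int. (\<Sum>i\<in>T. b i) = of_int (int (card T) + 2 * z)"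
  using assms
proof (induction T rule: finite_induct)
  case empty
  then show ?case by (auto intro: exI[of _ 0])
next
  case (insert i T)
  then obtain z where z: "(\<Sum>i\<in>T. b i) = of_int (int (card T) + 2 * z)" by auto
  have "b i = 1 \<or> b i = -1" using insert by auto
  then show ?case
  proof
    assume "b i = 1"
    then show ?thesis using insert z by (intro exI[of _ z]) simp
  next
    assume "b i = -1"
    then show ?thesis using insert z by (intro exI[of _ "z - 1"]) simp
  qed
qed

text \<open>An entry outside {0, 1, -1} would already cap the density at 1/2. The remaining nonzero
  entries are signs with sum -1, so their number is odd.\<close>

lemma oddvec_row:
  assumes "1 / 2 < dens (Suc k) B" "row k a \<in> B"
  shows "oddvec (Suc k) (row k a)"
proof -
  let ?b = "row k a"
  have sub: "supp ?b \<subseteq> {..<Suc k}" by (auto simp: supp_def row_def split: if_splits)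
  have pm: "?b i = 0 \<or> ?b i = 1 \<or> ?b i = -1" for i
  proof (cases "i < Suc k")
    case True
    then show ?thesis using dens_big_entry_half[OF assms(2) True] assms(1) by force
  next
    case False
    then show ?thesis using sub by (auto simp: supp_def)
  qed
  have "(\<Sum>i\<in>supp ?b. ?b i) = -1"
    using sum_row[of k a] sum.mono_neutral_left[OF _ sub, of ?b] by (auto simp: supp_def)
  moreover obtain z :: int where "(\<Sum>i\<in>supp ?b. ?b i) = of_int (int (card (supp ?b)) + 2 * z)"
    using sum_signs_parity[of "supp ?b" ?b] pm finite_subset[OF sub] by (auto simp: supp_def)
  ultimately have "int (card (supp ?b)) + 2 * z = -1"
    by (metis of_int_eq_iff of_int_minus of_int_1)
  moreover have "odd n" if "int n + 2 * z = -1" for n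
    using that by presburger
  ultimately have "odd (card (supp ?b))" by blast
  then show ?thesis using pm sub by (simp add: oddvec_def)
qed

section \<open>From densities to the sizes in \<open>Hplus\<close>\<close>

lemma Hset_alt:
  "Hset n k = {card {x \<in> cube k. \<forall>a\<in>A ` {..<n - k}. (\<Sum>i<k. a i * x i) \<in> {0, 1}} |
     A :: nat \<Rightarrow> nat \<Rightarrow> real. True}"
proof -
  have "(\<forall>a\<in>A ` {..<m}. P a) \<longleftrightarrow> (\<forall>j<m. P (A j))" for A :: "nat \<Rightarrow> nat \<Rightarrow> real" and m P
    by auto
  then show ?thesis unfolding Hset_def by (simp only:)
qed

lemma Hset_dens:
  "h \<in> Hset n k \<longleftrightarrow> (\<exists>A :: nat \<Rightarrow> nat \<Rightarrow> real. real h = 2 ^ k * dens (Suc k) (row k ` A ` {..<n - k}))"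
  unfolding Hset_alt card_cube_dens(2)[symmetric] of_nat_eq_iff by auto

text \<open>The origin lies in every intersection. Size 0 is thus excluded, so removing
  \<open>{1..2^(k-1)}\<close> leaves precisely the sizes above 2^(k-1).\<close>

lemma Hinf_pos:
  assumes "h \<in> Hinf k"
  shows "0 < h"
proof -
  obtain n and A :: "nat \<Rightarrow> nat \<Rightarrow> real" where
    h: "h = card {x \<in> cube k. \<forall>a\<in>A ` {..<n - k}. (\<Sum>i<k. a i * x i) \<in> {0, 1}}"
    using assms unfolding Hinf_def Hset_alt by blast
  have "(\<lambda>_. 0) \<in> {x \<in> cube k. \<forall>a\<in>A ` {..<n - k}. (\<Sum>i<k. a i * x i) \<in> {0, 1}}"
    by (simp add: cube_def)
  then have "{x \<in> cube k. \<forall>a\<in>A ` {..<n - k}. (\<Sum>i<k. a i * x i) \<in> {0, 1}} \<noteq> {}"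
    by blast
  then show ?thesis
    unfolding h card_gt_0_iff using card_cube_dens(1)[where R = "A ` {..<n - k}"] by blast
qed

lemma pow2_real:
  assumes "1 \<le> s" "s \<le> k"
  shows "2 ^ k * (1 / 2 + 1 / 2 ^ s) = real (2 ^ (k - 1) + 2 ^ (k - s))"
proof -
  have "(2::real) ^ (k - 1) = 2 ^ k / 2" using assms by (simp add: power_diff)
  moreover have "(2::real) ^ (k - s) = 2 ^ k / 2 ^ s" using assms by (simp add: power_diff)
  ultimately show ?thesis by (simp add: distrib_left)
qed

lemma pow2_special:
  assumes "6 \<le> k"
  shows "2 ^ k * (35 / 64) = real (2 ^ (k - 1) + 2 ^ (k - 5) + 2 ^ (k - 6))"
proof -
  obtain m where "k = 6 + m" using le_Suc_ex[OF assms] ..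
  then show ?thesis by (simp add: power_add)
qed

lemma Hplus_iff:
  "h \<in> Hplus k \<longleftrightarrow> 2 ^ (k - 1) < h \<and>
    (\<exists>m (A :: nat \<Rightarrow> nat \<Rightarrow> real). real h = 2 ^ k * dens (Suc k) (row k ` A ` {..<m}))"
proof -
  have Hinf: "h \<in> Hinf k \<longleftrightarrow> (\<exists>m (A :: nat \<Rightarrow> nat \<Rightarrow> real). real h = 2 ^ k * dens (Suc k) (row k ` A ` {..<m}))"
    (is "_ \<longleftrightarrow> ?R")
  proof
    assume "h \<in> Hinf k" then show ?R by (auto simp: Hinf_def Hset_dens)
  next
    assume ?R
    then obtain m and A :: "nat \<Rightarrow> nat \<Rightarrow> real" where
      "real h = 2 ^ k * dens (Suc k) (row k ` A ` {..<m})" by blast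
    then have "h \<in> Hset (k + m) k" by (auto simp: Hset_dens)
    then show "h \<in> Hinf k" by (auto simp: Hinf_def)
  qed
  have "h \<in> Hplus k \<longleftrightarrow> 2 ^ (k - 1) < h \<and> h \<in> Hinf k"
    using Hinf_pos[of h k] by (auto simp: Hplus_def)
  then show ?thesis unfolding Hinf .
qed

lemma Hplus_upper:
  assumes k: "6 \<le> k" and h: "h \<in> Hplus k"
  shows "h \<in> {2^(k-1) + 2^i | i. i < k} \<union> {2^(k-1) + 2^(k-5) + 2^(k-6)}"
proof -
  obtain m and A :: "nat \<Rightarrow> nat \<Rightarrow> real" where
    hd: "2 ^ (k - 1) < h" "real h = 2 ^ k * dens (Suc k) (row k ` A ` {..<m})"
    using h by (auto simp: Hplus_iff)
  let ?B = "row k ` A ` {..<m}"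
  have "real (2 ^ (k - 1)) < 2 ^ k * dens (Suc k) ?B" using hd by (metis of_nat_less_iff)
  moreover have "(2::real) ^ k = 2 * 2 ^ (k - 1)" using k by (simp flip: power_Suc)
  ultimately have gt: "1 / 2 < dens (Suc k) ?B" by simp
  have odd: "oddvec (Suc k) b" if "b \<in> ?B" for b
    using oddvec_row[OF gt] that by blast
  \<comment> \<open>Rows with a single nonzero entry hold for every sign vector; odd support means
    that all the others have at least three entries.\<close>
  define F where "F = {b \<in> ?B. 3 \<le> card (supp b)}"
  have "dens (Suc k) ?B = dens (Suc k) F"
  proof (rule dens_cong)
    fix y assume y: "y \<in> signs (Suc k)"
    have "\<bar>dot (Suc k) b y\<bar> = 1" if "b \<in> ?B" "b \<notin> F" for b
    proof -
      have "card (supp b) < 3" "odd (card (supp b))" using that odd[OF that(1)] by (auto simp: F_def oddvec_def)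
      then have "card (supp b) = 1" by (auto elim!: oddE)
      then show ?thesis using ok_trivial[OF odd[OF that(1)] _ y] by simp
    qed
    then show "ok (Suc k) ?B y = ok (Suc k) F y" unfolding ok_def F_def by blast
  qed
  moreover have "large_density (Suc k) (dens (Suc k) F)"
    using k odd gt calculation by (intro dens_classification) (auto simp: F_def)
  ultimately consider "dens (Suc k) ?B = 35 / 64"
    | s where "1 \<le> s" "s < Suc k" "dens (Suc k) ?B = 1 / 2 + 1 / 2 ^ s"
    by (auto simp: large_density_def)
  then show ?thesis
  proof cases
    case 1
    then have "real h = real (2 ^ (k - 1) + 2 ^ (k - 5) + 2 ^ (k - 6))"
      unfolding hd(2) using pow2_special[OF k] by (simp only:)
    then show ?thesis by (simp only: of_nat_eq_iff) simp
  next
    case 2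
    then have "real h = real (2 ^ (k - 1) + 2 ^ (k - s))" using hd(2) pow2_real[of s k] by simp
    then have "h = 2 ^ (k - 1) + 2 ^ (k - s)" by (simp only: of_nat_eq_iff)
    moreover have "k - s < k" using 2 k by simp
    ultimately show ?thesis by blast
  qed
qed

section \<open>Attaining the listed sizes\<close>

lemma Hplus_powers:
  assumes "i < k"
  shows "2 ^ (k - 1) + 2 ^ i \<in> Hplus k"
proof -
  define m where "m = k - 1 - i"
  \<comment> \<open>Row \<open>j\<close> demands that the coordinates 0 and \<open>Suc j\<close> are
    not both 1. If coordinate 0 is 0, all 2^(k-1) points survive; if it is 1, then \<open>m\<close>
    coordinates are forced to 0 and 2^(k-1-m) = 2^i points remain. After homogenization the rows
    form a star through 0 and \<open>k\<close>.\<close>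
  define A :: "nat \<Rightarrow> nat \<Rightarrow> real" where "A j l = of_bool (l = 0 \<or> l = Suc j)" for j l
  have mk: "m < k" using assms by (simp add: m_def)
  have row: "row k (A j) = (\<lambda>l. if l = 0 \<or> l = Suc j then -1 else if l = k then 1 else 0)"
    if j: "j < m" for j
  proof -
    have "(\<Sum>l<k. A j l) = (\<Sum>l\<in>{0, Suc j}. 1)"
      using j mk by (intro sum.mono_neutral_cong_right) (auto simp: A_def)
    then show ?thesis using j mk by (auto simp: row_def A_def fun_eq_iff)
  qed
  have supp: "supp (row k (A j)) = {0, k, Suc j}" if "j < m" for j
    using row[OF that] by (auto simp: supp_def)
  let ?F = "row k ` A ` {..<m}"
  have F: "oddvec (Suc k) b \<and> star 0 k (-1) b" if b: "b \<in> ?F" for b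
  proof -
    obtain j where j: "j < m" "b = row k (A j)" using b by blast
    have "Suc j < k" using j mk by simp
    then have "card (supp b) = 3" using supp[OF j(1)] j(2) by simp
    then show ?thesis
      using j mk supp[OF j(1)] row[OF j(1)] by (auto simp: oddvec_def star_def)
  qed
  have cons: "b 0 * b l = b' 0 * b' l"
    if h: "b \<in> ?F" "b' \<in> ?F" "l \<notin> {0, k}" "b l \<noteq> 0" "b' l \<noteq> 0" for b b' l
    using h row by (auto split: if_splits)
  have "\<Union> (supp ` ?F) - {0, k} = Suc ` {..<m}"
    using supp mk by (auto simp: image_iff)
  then have "card (\<Union> (supp ` ?F) - {0, k}) = m" by (simp add: card_image)
  moreover have "dens (Suc k) ?F = 1 / 2 + 1 / 2 ^ (card (\<Union> (supp ` ?F) - {0, k}) + 1)"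
  proof (rule dens_star[where c = "-1"])
    show "0 \<noteq> k" using assms by simp
    show "oddvec (Suc k) b" if "b \<in> ?F" for b using F[OF that] ..
    show "star 0 k (-1) b" if "b \<in> ?F" for b using F[OF that] ..
    show "b 0 * b l = b' 0 * b' l"
      if "b \<in> ?F" "b' \<in> ?F" "l \<notin> {0, k}" "b l \<noteq> 0" "b' l \<noteq> 0" for b b' l
      using that by (rule cons)
  qed simp_all
  ultimately have "dens (Suc k) ?F = 1 / 2 + 1 / 2 ^ (m + 1)" by simp
  then have "real (2 ^ (k - 1) + 2 ^ i) = 2 ^ k * dens (Suc k) ?F"
    using pow2_real[of "m + 1" k] assms by (simp add: m_def)
  then show ?thesis unfolding Hplus_iff by (intro conjI exI[of _ m] exI[of _ A]) (simp, simp only:)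
qed

lemma Hplus_special:
  assumes "6 \<le> k"
  shows "2 ^ (k - 1) + 2 ^ (k - 5) + 2 ^ (k - 6) \<in> Hplus k"
proof -
  \<comment> \<open>Three entries 1 and three entries -1 sum to 0, so the homogenizing entry is -1
    and the row has exactly seven nonzero entries, giving density 35/64.\<close>
  define a :: "nat \<Rightarrow> real" where "a l = (if l < 3 then 1 else if l < 6 then -1 else 0)" for l
  have "(\<Sum>l<k. a l) = (\<Sum>l<6. a l)"
    using assms by (intro sum.mono_neutral_right) (auto simp: a_def)
  also have "\<dots> = 0" by (simp add: a_def eval_nat_numeral)
  finally have row: "row k a = (\<lambda>l. if l < k then - a l else if l = k then -1 else 0)"
    by (auto simp: row_def fun_eq_iff)
  then have supp: "supp (row k a) = insert k {..<6}"
    using assms by (auto simp: supp_def a_def split: if_splits)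
  then have c: "card (supp (row k a)) = 7" using assms by simp
  then have "oddvec (Suc k) (row k a)"
    using row supp assms by (auto simp: oddvec_def a_def)
  then have "dens (Suc k) {row k a} = 35 / 64"
    using dens_single[of "Suc k" "row k a" 3] c delta_values(3) by (simp del: delta.simps)
  moreover have "row k ` (\<lambda>_. a) ` {..<1::nat} = {row k a}" by auto
  ultimately have "real (2 ^ (k - 1) + 2 ^ (k - 5) + 2 ^ (k - 6)) =
      2 ^ k * dens (Suc k) (row k ` (\<lambda>_. a) ` {..<1::nat})"
    using pow2_special[OF assms] by (simp only:)
  then show ?thesis
    unfolding Hplus_iff by (intro conjI exI[of _ 1] exI[of _ "\<lambda>_. a"]) (simp, simp only:)
qed

theorem theorem1p1:
  fixes k :: nat
  assumes "k \<ge> 6"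
  shows "Hplus k = {2^(k-1) + 2^i | i. i < k} \<union> {2^(k-1) + 2^(k-5) + 2^(k-6)}"
  using Hplus_upper[OF assms] Hplus_powers Hplus_special[OF assms] by auto

end
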